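(* Let $\theta>0$, $0\le\alpha<n$, and let $1<p\le q<\infty$ satisfy $\frac1p-\frac1q=\frac{\alpha}{n}$. Let $\gamma=\theta/\big(1+\frac{p'}{q}\big)$. Then there is a constant $C$, independent of the weight, such that for every weight $w$ in $A_{p,q}^{\alpha,\gamma/3}$, $$\|M^{\theta,\alpha}: L^p(w^p)\to L^q(w^q)\|\le C\,[w]_{A_{p,q}^{\alpha,\gamma/3}}^{\frac{p'}{q}\left(1-\frac{\alpha}{n}\right)} .$$
   Context: Let $n\ge 3$ and let $L=-\Delta+V$ be a Schrödinger operator on $\mathbb{R}^n$, where $V\ge 0$ is a locally integrable function in the reverse Hölder class $RH_s$ for some $s\ge n/2$: there is a constant $C_V$ with $\big(\frac1{|Q|}\int_Q V^s\big)^{1/s}\le \frac{C_V}{|Q|}\int_Q V$ for all cubes $Q$ (left side replaced by the essential supremum over $Q$ if $s=\infty$). $L$ is fixed, and constants may depend on $n$ and $V$. The critical function is $$\rho(x)=\sup\Big\{r>0:\ \frac1{r^{n-2}}\int_{B(x,r)}V(y)\,dy\le 1\Big\}$$ (if $V\equiv0$ then $\rho=\infty$ and $\ell/\rho$ is read as $0$). All cubes have sides parallel to the axes; $c_Q$, $\ell(Q)$, $|Q|$ denote the center, side-length and volume of $Q$, and $\mathbf 1_Q$ its indicator function. For $\theta>0$ set $\psi_\theta(Q)=\big(1+\frac{\ell(Q)}{\rho(c_Q)}\big)^\theta$. A weight is a non-negative (a.e. positive) locally integrable function; $\|f\|_{L^p(v)}^p=\int|f|^pv$, $p'=p/(p-1)$.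 For $\theta>0$, the class $A_{p,q}^{\alpha,\theta}$ consists of the weights with $$[w]_{A_{p,q}^{\alpha,\theta}}=\sup_Q\Big(\frac1{\psi_\theta(Q)|Q|}\int_Q w^q\Big)\Big(\frac1{\psi_\theta(Q)|Q|}\int_Q w^{-p'}\Big)^{q/p'}<\infty .$$ The fractional maximal function is $$M^{\theta,\alpha} f(x)=\sup_Q\frac{\mathbf 1_Q(x)}{(\psi_\theta(Q)|Q|)^{1-\frac{\alpha}{n}}}\int_Q|f(y)|\,dy .$$ $\|T:X\to Y\|$ denotes the operator norm. *)

theory Defs
  imports "HOL-Analysis.Analysis" "HOL-Probability.Essential_Supremum"
begin

text \<open>All integrals and averages are taken in \<^typ>\<open>ennreal\<close>, with respect to Lebesgue measure. The
  library has no real powers on \<^typ>\<open>ennreal\<close>.\<close>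

definition ennpowr :: "ennreal \<Rightarrow> real \<Rightarrow> ennreal" where
  "ennpowr x a =
     (if x = top then (if a > 0 then top else if a = 0 then 1 else 0)
      else if x = 0 \<and> a < 0 then top
      else if a = 0 then 1
      else ennreal (enn2real x powr a))"

definition conj_exponent :: "real \<Rightarrow> real" where
  "conj_exponent p = p / (p - 1)"

definition cube :: "real ^ 'n \<Rightarrow> real \<Rightarrow> (real ^ 'n) set" where
  "cube c l = cbox (\<chi> i. c $ i - l / 2) (\<chi> i. c $ i + l / 2)"

definition cube_vol :: "real ^ 'n \<Rightarrow> real \<Rightarrow> ennreal" where
  "cube_vol c l = emeasure lebesgue (cube c l)"

definition locally_integrable :: "(real ^ 'n \<Rightarrow> real) \<Rightarrow> bool" where
  "locally_integrable f \<longleftrightarrow> (\<forall>K. compact K \<longrightarrow> f absolutely_integrable_on K)"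

definition reverse_Hoelder :: "ennreal \<Rightarrow> (real ^ 'n \<Rightarrow> real) \<Rightarrow> bool" where
  "reverse_Hoelder s V \<longleftrightarrow>
     (\<exists>C::real. \<forall>c l. l > 0 \<longrightarrow>
        (if s = top then esssup (lebesgue_on (cube c l)) (\<lambda>y. ennreal (V y))
         else ennpowr ((1 / cube_vol c l) *
                (\<integral>\<^sup>+y\<in>cube c l. ennreal (V y powr enn2real s) \<partial>lebesgue)) (1 / enn2real s))
        \<le> ennreal C / cube_vol c l * (\<integral>\<^sup>+y\<in>cube c l. ennreal (V y) \<partial>lebesgue))"

definition critical_radius :: "(real ^ 'n \<Rightarrow> real) \<Rightarrow> real ^ 'n \<Rightarrow> ennreal" where
  "critical_radius V x =
     Sup {ennreal r | r. r > 0 \<and>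
       (1 / ennreal (r ^ (CARD('n) - 2))) * (\<integral>\<^sup>+y\<in>ball x r. ennreal (V y) \<partial>lebesgue) \<le> 1}"

text \<open>In \<^typ>\<open>ennreal\<close> the quotient of a real by \<^term>\<open>top\<close> is \<open>0\<close>, which is the convention required
  when \<open>V\<close> vanishes almost everywhere.\<close>

definition psi :: "(real ^ 'n \<Rightarrow> real) \<Rightarrow> real \<Rightarrow> real ^ 'n \<Rightarrow> real \<Rightarrow> ennreal" where
  "psi V \<theta> c l = ennpowr (1 + ennreal l / critical_radius V c) \<theta>"

definition weight :: "(real ^ 'n \<Rightarrow> real) \<Rightarrow> bool" where
  "weight w \<longleftrightarrow> locally_integrable w \<and> (\<forall>x. w x \<ge> 0) \<and> (AE x in lebesgue. w x > 0)"

text \<open>\<open>0 powr a = 0\<close> for every \<open>a\<close>, so the second integrand below is \<open>0\<close> instead of \<open>\<infinity>\<close>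
  where \<open>w\<close> vanishes. For a weight this happens only on a null set.\<close>

definition Apq_const ::
  "(real ^ 'n \<Rightarrow> real) \<Rightarrow> real \<Rightarrow> real \<Rightarrow> real \<Rightarrow> (real ^ 'n \<Rightarrow> real) \<Rightarrow> ennreal" where
  "Apq_const V \<theta> p q w =
     (SUP c. SUP l\<in>{0<..}.
        (1 / (psi V \<theta> c l * cube_vol c l) *
           (\<integral>\<^sup>+y\<in>cube c l. ennreal (w y powr q) \<partial>lebesgue)) *
        ennpowr (1 / (psi V \<theta> c l * cube_vol c l) *
           (\<integral>\<^sup>+y\<in>cube c l. ennreal (w y powr (- conj_exponent p)) \<partial>lebesgue))
          (q / conj_exponent p))"

definition Apq_class ::
  "(real ^ 'n \<Rightarrow> real) \<Rightarrow> real \<Rightarrow> real \<Rightarrow> real \<Rightarrow> (real ^ 'n \<Rightarrow> real) set" where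
  "Apq_class V \<theta> p q = {w. weight w \<and> Apq_const V \<theta> p q w < top}"

definition frac_maximal ::
  "(real ^ 'n \<Rightarrow> real) \<Rightarrow> real \<Rightarrow> real \<Rightarrow> (real ^ 'n \<Rightarrow> real) \<Rightarrow> real ^ 'n \<Rightarrow> ennreal" where
  "frac_maximal V \<theta> \<alpha> f x =
     (SUP c. SUP l\<in>{0<..}.
        indicator (cube c l) x / ennpowr (psi V \<theta> c l * cube_vol c l) (1 - \<alpha> / real CARD('n)) *
        (\<integral>\<^sup>+y\<in>cube c l. ennreal \<bar>f y\<bar> \<partial>lebesgue))"

definition Lp_norm :: "real \<Rightarrow> (real ^ 'n \<Rightarrow> real) \<Rightarrow> (real ^ 'n \<Rightarrow> ennreal) \<Rightarrow> ennreal" where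
  "Lp_norm p v g = ennpowr (\<integral>\<^sup>+x. ennpowr (g x) p * ennreal (v x) \<partial>lebesgue) (1 / p)"

definition Lp_space :: "real \<Rightarrow> (real ^ 'n \<Rightarrow> real) \<Rightarrow> (real ^ 'n \<Rightarrow> real) set" where
  "Lp_space p v = {f \<in> borel_measurable lebesgue. Lp_norm p v (\<lambda>x. ennreal \<bar>f x\<bar>) < top}"

text \<open>The supremum of the quotients of norms, as in \<^const>\<open>onorm\<close>. The quotient is \<open>0\<close> when both
  norms vanish, and \<^term>\<open>top\<close> when only the denominator does.\<close>

definition op_norm ::
  "real \<Rightarrow> (real ^ 'n \<Rightarrow> real) \<Rightarrow> real \<Rightarrow> (real ^ 'n \<Rightarrow> real) \<Rightarrow>
   ((real ^ 'n \<Rightarrow> real) \<Rightarrow> real ^ 'n \<Rightarrow> ennreal) \<Rightarrow> ennreal" where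
  "op_norm p v q u T =
     (SUP f\<in>Lp_space p v. Lp_norm q u (T f) / Lp_norm p v (\<lambda>x. ennreal \<bar>f x\<bar>))"

end

(*
  By the one-third trick every cube Q lies in a cell P of one of 2^n shifted dyadic grids, with P
  contained in the concentric cube 12Q.  Since rho is evaluated at the common centre, psi(12Q) is at
  most a constant times psi(Q), and testing A_{p,q} on 12Q bounds the average of |f| over Q:
  with u = w^q, sigma = w^{-p'}, a = 1 - alpha/n, kappa = p' a = 1 + p'/q and b = kappa/q, it is at
  most
    C [w]^b ( |P|/u(P) (sigma(P)^{-a} int_P |f|)^{1/b} )^b.
  The inner factor is at most G(y) for every y in P, where G is the fractional dyadic maximal
  function of f/sigma with respect to sigma; hence the whole is at most
  C [w]^b (M_u (G^{1/b} / u))^b.  Dyadic maximal functions are bounded with constants that do not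
  depend on the measure: M_u on L^kappa(u), G from L^p(sigma) to L^q(sigma).
*)
theory Submission
  imports Defs
begin

section \<open>Real powers of extended nonnegative reals\<close>

text \<open>The composition of the two dyadic maximal functions is Lerner's device for Buckley's
  sharp exponent; for p = q it reads (M_u ((M_\<sigma> (f/\<sigma>))^(p-1) / u))^(1/(p-1)). The
  obstacle is that psi depends on the centre of a cube, and rho at the centre of P is not comparable
  to rho at the centre of Q without further work. Every factor psi is therefore spent before P is
  introduced: it occurs only for Q and 12Q, and the grid operators are free of it. The exponents are
  forced. Raising the testing inequality to the power b gives \<sigma>(P) the exponent (q/p') b = a
  that the fractional average needs. The factor psi then enters with exponent (\<gamma>/3)(1 + q/p')
  b = \<theta> a / 3, which the \<theta> a in the definition of the maximal function absorbs. On the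
  way back, b q = \<kappa> turns the L^q norm of the b-th power into an L^\<kappa>(u) norm, and
  u^(1-\<kappa>) = \<sigma> turns that into an L^q(\<sigma>) norm of G.\<close>

lemma ennpowr_ennreal: "0 \<le> x \<Longrightarrow> 0 < a \<Longrightarrow> ennpowr (ennreal x) a = ennreal (x powr a)"
  by (simp add: ennpowr_def)

lemma ennpowr_top [simp]: "0 < a \<Longrightarrow> ennpowr top a = top"
  by (simp add: ennpowr_def)

lemma ennpowr_0 [simp]: "0 < a \<Longrightarrow> ennpowr 0 a = 0"
  by (simp add: ennpowr_def)

lemma ennpowr_one [simp]: "ennpowr x 1 = x"
  by (cases x) (auto simp: ennpowr_ennreal)

lemma ennpowr_mono: "0 < a \<Longrightarrow> x \<le> y \<Longrightarrow> ennpowr x a \<le> ennpowr y a"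
  by (cases x; cases y) (auto simp: ennpowr_ennreal ennreal_le_iff intro!: ennreal_leI powr_mono2 simp: top_unique)

lemma ennpowr_mult:
  assumes "0 < a" shows "ennpowr (x * y) a = ennpowr x a * ennpowr y a"
proof (cases x; cases y)
  fix r s assume "0 \<le> r" "x = ennreal r" "0 \<le> s" "y = ennreal s"
  then show ?thesis
    using assms by (simp add: ennpowr_ennreal powr_mult flip: ennreal_mult)
qed (use assms in \<open>auto simp: ennreal_top_mult ennreal_mult_top ennpowr_ennreal\<close>)

lemma ennpowr_ennpowr:
  "0 < a \<Longrightarrow> 0 < b \<Longrightarrow> ennpowr (ennpowr x a) b = ennpowr x (a * b)"
  by (cases x) (auto simp: ennpowr_ennreal powr_powr)

lemma ennpowr_add:
  "0 < a \<Longrightarrow> 0 < b \<Longrightarrow> ennpowr x (a + b) = ennpowr x a * ennpowr x b"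
  by (cases x) (auto simp: ennpowr_ennreal powr_add ennreal_mult)

lemma borel_measurable_ennpowr [measurable (raw)]:
  assumes "f \<in> borel_measurable M" "0 < a"
  shows "(\<lambda>x. ennpowr (f x) a) \<in> borel_measurable M"
proof -
  have "(\<lambda>x. ennpowr x a) = (\<lambda>x. if x = top then top else ennreal (enn2real x powr a))"
    using assms(2) by (auto simp: ennpowr_def)
  then have "(\<lambda>x. ennpowr x a) \<in> borel_measurable borel"
    by simp
  then show ?thesis
    using assms(1) by (rule measurable_compose[rotated])
qed

text \<open>Stated pointwise, so that \<open>maximal_strong\<close> can integrate it over
  \<open>M\<close> and exchange the integrals. The height may be infinite, as maximal functions can
  be.\<close>

lemma layer_cake:
  assumes p: "0 < p"
  shows "ennreal p * (\<integral>\<^sup>+t. (if 0 < t \<and> ennreal t < h then ennreal (t powr (p - 1)) else 0) \<partial>lborel) =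
         ennpowr h p"
proof -
  let ?I = "\<lambda>h. \<integral>\<^sup>+t. (if 0 < t \<and> ennreal t < h then ennreal (t powr (p - 1)) else 0) \<partial>lborel"
  have fin: "ennreal p * ?I (ennreal c) = ennpowr (ennreal c) p" if c: "0 \<le> c" for c
  proof -
    have "((\<lambda>x. x powr (p - 1)) has_integral (c powr (p - 1 + 1) / (p - 1 + 1))) {0..c}"
      using p c by (intro has_integral_powr_from_0) auto
    then have "(\<integral>\<^sup>+t. ennreal (indicator {0..c} t * t powr (p - 1)) \<partial>lborel) = ennreal (c powr p / p)"
      using nn_integral_has_integral_lebesgue[of "{0..c}" "\<lambda>t. t powr (p - 1)" "c powr p / p"] by simp
    moreover have "?I (ennreal c) = (\<integral>\<^sup>+t. ennreal (indicator {0..c} t * t powr (p - 1)) \<partial>lborel)"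
    proof (rule nn_integral_cong_AE)
      show "AE t in lborel. (if 0 < t \<and> ennreal t < ennreal c then ennreal (t powr (p - 1)) else 0) =
              ennreal (indicator {0..c} t * t powr (p - 1))"
        using AE_lborel_singleton[of 0] AE_lborel_singleton[of c]
        by eventually_elim (auto simp: ennreal_less_iff indicator_def)
    qed
    ultimately show ?thesis
      using p c by (simp add: ennpowr_ennreal flip: ennreal_mult)
  qed
  show ?thesis
  proof (cases h)
    case (real r)
    then show ?thesis using fin by simp
  next
    case top
    \<comment> \<open>At infinite height, comparison with the finite height x^(1/p) shows that the
      left side exceeds every real.\<close>
    have le: "ennreal x \<le> ennreal p * ?I h" if "0 \<le> x" for x
    proof -
      have "ennreal x = ennpowr (ennreal (x powr (1 / p))) p"
        using that p by (simp add: ennpowr_ennreal powr_powr)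
      also have "\<dots> = ennreal p * ?I (ennreal (x powr (1 / p)))"
        by (rule fin[symmetric]) simp
      also have "\<dots> \<le> ennreal p * ?I h"
        unfolding top by (intro mult_left_mono nn_integral_mono) auto
      finally show ?thesis .
    qed
    have "ennreal p * ?I h = top"
    proof (cases "ennreal p * ?I h")
      case (real r)
      then show ?thesis
        using le[of "r + 1"] by (simp add: ennreal_le_iff del: ennreal_plus)
    qed
    then show ?thesis using p top by simp
  qed
qed

text \<open>Hoelder's inequality against the indicator of \<open>A\<close>, obtained by integrating
  a Young inequality with a free scale \<open>m\<close> and then choosing \<open>m\<close>.\<close>

lemma ennpowr_nn_set_integral_le:
  assumes g [measurable]: "g \<in> borel_measurable M" and A [measurable]: "A \<in> sets M"
    and fin: "emeasure M A \<noteq> top" and p: "1 < p"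
  shows "ennpowr (\<integral>\<^sup>+x\<in>A. g x \<partial>M) p \<le>
         (\<integral>\<^sup>+x\<in>A. ennpowr (g x) p \<partial>M) * ennpowr (emeasure M A) (p - 1)"
    (is "ennpowr ?I p \<le> ?F * _")
proof (cases "emeasure M A = 0 \<or> ?F = top")
  case True
  then consider "emeasure M A = 0" | "emeasure M A \<noteq> 0" "?F = top" by blast
  then show ?thesis
  proof cases
    case 1
    then have "?I = 0"
      using nn_integral_null_set[of A M g] A by (simp add: null_sets_def)
    then show ?thesis using p by simp
  next
    case 2
    then have "ennpowr (emeasure M A) (p - 1) \<noteq> 0"
      using p fin by (cases "emeasure M A") (auto simp: ennpowr_ennreal)
    then show ?thesis using 2 by (simp add: ennreal_top_mult)
  qed
next
  case False
  obtain s where s: "emeasure M A = ennreal s" "0 < s"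
    using False fin by (cases "emeasure M A") auto
  obtain f where f: "?F = ennreal f" "0 \<le> f"
    using False by (cases ?F) auto
  \<comment> \<open>The tangent line of the p-th power at \<open>m\<close>, solved for
    \<open>x\<close>.\<close>
  have young: "x \<le> ennreal m * (ennreal (1 / (p * m powr p)) * ennpowr x p + ennreal (1 - 1 / p))"
    if m: "0 < m" for x m
  proof (cases x)
    case (real r)
    have "(r / m) * 1 \<le> (r / m) powr p / p + 1 powr (p / (p - 1)) / (p / (p - 1))"
      using p m real by (intro Youngs_inequality) (auto simp: field_simps)
    then have "r \<le> m * ((r / m) powr p / p + (1 - 1 / p))"
      using p m by (simp add: field_simps)
    also have "\<dots> = m * (1 / (p * m powr p) * r powr p + (1 - 1 / p))"
      using m real p by (simp add: powr_divide field_simps)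
    finally show ?thesis
      using real p m by (simp add: ennpowr_ennreal ennreal_leI flip: ennreal_mult ennreal_plus)
  qed (use p m in \<open>simp add: ennreal_mult_top\<close>)
  have bound: "?I \<le> ennreal (m * (1 / (p * m powr p) * f + (1 - 1 / p) * s))" if m: "0 < m" for m
  proof -
    have "?I \<le> (\<integral>\<^sup>+x. ennreal m * (ennreal (1 / (p * m powr p)) * (ennpowr (g x) p * indicator A x) +
            ennreal (1 - 1 / p) * indicator A x) \<partial>M)"
      using young[OF m] by (intro nn_integral_mono) (auto split: split_indicator)
    also have "\<dots> = ennreal m * (ennreal (1 / (p * m powr p)) * ?F + ennreal (1 - 1 / p) * emeasure M A)"
      using p by (simp add: nn_integral_cmult nn_integral_add)
    also have "\<dots> = ennreal (m * (1 / (p * m powr p) * f + (1 - 1 / p) * s))"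
      using p m s f by (simp flip: ennreal_mult ennreal_plus)
    finally show ?thesis .
  qed
  obtain i where i: "?I = ennreal i" "0 \<le> i"
    using bound[of 1] by (cases ?I) (auto simp: top_unique)
  have "i powr p \<le> f * s powr (p - 1)"
  proof (cases "i = 0")
    case False
    \<comment> \<open>The average of \<open>g\<close> over \<open>A\<close> is the scale at which
      the tangent bound is sharp for constant functions.\<close>
    define m where "m = i / s"
    have m: "0 < m" "i = m * s"
      using i False s by (auto simp: m_def)
    have "i \<le> m * (1 / (p * m powr p) * f + (1 - 1 / p) * s)"
      using bound[OF m(1)] i m s p f by (subst (asm) i(1), subst (asm) ennreal_le_iff) auto
    then have "s \<le> 1 / (p * m powr p) * f + (1 - 1 / p) * s"
      using m by simp
    then have "s * m powr p \<le> f"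
      using p m by (simp add: field_simps)
    then have "s * m powr p * s powr (p - 1) \<le> f * s powr (p - 1)"
      by (intro mult_right_mono) auto
    also have "s * m powr p * s powr (p - 1) = i powr p"
      using m s powr_add[of s 1 "p - 1"] by (simp add: powr_mult)
    finally show ?thesis .
  qed (use f p in simp)
  then show ?thesis
    using i f s p by (simp add: ennpowr_ennreal ennreal_leI flip: ennreal_mult)
qed

section \<open>Maximal functions of nested partitions\<close>

text \<open>An abstract dyadic filtration: \<open>P k x\<close> is the cell of generation
  \<open>k\<close> around \<open>x\<close>, coarser as \<open>k\<close> grows. No doubling relates a
  cell to its parent, which is why the constants below do not depend on \<open>M\<close>.\<close>

locale nested_partition = sigma_finite_measure M for M :: "'a measure" +
  fixes P :: "int \<Rightarrow> 'a \<Rightarrow> 'a set"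
  assumes space_UNIV: "space M = UNIV"
    and self: "x \<in> P k x"
    and cell_eq: "y \<in> P k x \<Longrightarrow> P k y = P k x"
    and step: "P k x \<subseteq> P (k + 1) x"
    and cell_sets [measurable]: "P k x \<in> sets M"
    and countable_cells: "countable (range (P k))"
begin

text \<open>In \<^typ>\<open>ennreal\<close>, \<open>x / \<infinity> = 0\<close> even for \<open>x = \<infinity>\<close>: cells of infinite measure contribute nothing.\<close>

definition avg :: "('a \<Rightarrow> ennreal) \<Rightarrow> 'a set \<Rightarrow> ennreal" where
  "avg g A = (\<integral>\<^sup>+x\<in>A. g x \<partial>M) / emeasure M A"

definition maximal :: "('a \<Rightarrow> ennreal) \<Rightarrow> 'a \<Rightarrow> ennreal" where
  "maximal g x = (SUP k. avg g (P k x))"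

definition frac_max :: "real \<Rightarrow> ('a \<Rightarrow> ennreal) \<Rightarrow> 'a \<Rightarrow> ennreal" where
  "frac_max a g x = (SUP k. (\<integral>\<^sup>+y\<in>P k x. g y \<partial>M) / ennpowr (emeasure M (P k x)) a)"

lemma cell_mono: "k \<le> j \<Longrightarrow> P k x \<subseteq> P j x"
  by (induction j rule: int_ge_induct) (use step in blast)+

lemma cell_function_measurable:
  "(\<lambda>x. F (P k x)) \<in> borel_measurable M" for F :: "'a set \<Rightarrow> ennreal"
proof (rule borel_measurableI_greater)
  fix y
  have "{x \<in> space M. y < F (P k x)} = \<Union>{C \<in> range (P k). y < F C}"
    using self cell_eq by (fastforce simp: space_UNIV)
  also have "\<dots> \<in> sets M"
    using countable_cells by (intro sets.countable_Union) auto
  finally show "{x \<in> space M. y < F (P k x)} \<in> sets M" .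
qed

lemma maximal_measurable [measurable]: "maximal g \<in> borel_measurable M"
  unfolding maximal_def [abs_def] by (intro borel_measurable_SUP cell_function_measurable) auto

lemma frac_max_measurable [measurable]: "frac_max a g \<in> borel_measurable M"
  unfolding frac_max_def [abs_def]
  by (intro borel_measurable_SUP
      cell_function_measurable[of "\<lambda>C. (\<integral>\<^sup>+y\<in>C. g y \<partial>M) / ennpowr (emeasure M C) a"]) auto

section \<open>Weak type (1,1) by selecting maximal cells\<close>

lemma integral_gt_of_avg_gt:
  assumes "t < avg g A"
  shows "t * emeasure M A \<le> (\<integral>\<^sup>+x\<in>A. g x \<partial>M)"
proof -
  have "emeasure M A \<noteq> top"
    using assms by (auto simp: avg_def divide_ennreal_def)
  moreover have "t * emeasure M A \<le> avg g A * emeasure M A"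
    using assms by (intro mult_right_mono) auto
  moreover have "\<dots> \<le> (\<integral>\<^sup>+x\<in>A. g x \<partial>M)"
  proof (cases "emeasure M A = 0")
    case False
    then show ?thesis
      using calculation(1) by (simp add: avg_def ennreal_divide_times ennreal_times_divide
          mult_divide_eq_ennreal)
  qed simp
  ultimately show ?thesis by order
qed

text \<open>The cap \<open>N\<close> on the generation guarantees that each point of
  \<open>E\<close> has a coarsest cell with average above \<open>t\<close>. These cells are pairwise
  disjoint and fill \<open>E\<close>, so the bound for a single cell can be summed.\<close>

lemma weak_type_truncated:
  fixes t :: ennreal and N :: int
  assumes g [measurable]: "g \<in> borel_measurable M"
  defines "E \<equiv> {x. \<exists>k\<le>N. t < avg g (P k x)}"
  shows "t * emeasure M E \<le> (\<integral>\<^sup>+x\<in>E. g x \<partial>M)"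
proof -
  define F where "F = {P k x | k x. k \<le> N \<and> t < avg g (P k x) \<and>
                         (\<forall>j. k < j \<and> j \<le> N \<longrightarrow> \<not> t < avg g (P j x))}"
  have "F \<subseteq> (\<Union>k. range (P k))"
    by (auto simp: F_def)
  then have F: "countable F"
    using countable_cells by (auto intro: countable_subset)
  have F_sets: "C \<in> sets M" if "C \<in> F" for C
    using that by (auto simp: F_def)
  have E: "E = \<Union>F"
  proof (intro equalityI subsetI)
    fix x assume "x \<in> E"
    then obtain k where k: "k \<le> N" "t < avg g (P k x)" by (auto simp: E_def)
    \<comment> \<open>Counting down from \<open>N\<close>, the least natural number picks the
      coarsest generation.\<close>
    define n where "n = (LEAST n. t < avg g (P (N - int n) x))"
    have ex: "t < avg g (P (N - int (nat (N - k))) x)"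
      using k by simp
    have n: "t < avg g (P (N - int n) x)"
      unfolding n_def by (rule LeastI, rule ex)
    have "\<not> t < avg g (P j x)" if j: "N - int n < j" "j \<le> N" for j
    proof -
      have "nat (N - j) < n" using j by auto
      then have "\<not> t < avg g (P (N - int (nat (N - j))) x)"
        unfolding n_def by (rule not_less_Least)
      then show ?thesis using j by simp
    qed
    then have "P (N - int n) x \<in> F"
      using n unfolding F_def by (intro CollectI exI[of _ "N - int n"] exI[of _ x]) auto
    then show "x \<in> \<Union>F"
      using self by blast
  next
    fix x assume "x \<in> \<Union>F"
    then obtain k y where "k \<le> N" "t < avg g (P k y)" "x \<in> P k y"
      by (auto simp: F_def)
    then show "x \<in> E"
      using cell_eq[of x k y] by (auto simp: E_def)
  qed
  \<comment> \<open>If selected cells of different generations met, the finer would lie inside the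
    coarser, against its maximality.\<close>
  have aux: False if "k < j" "j \<le> N" "t < avg g (P j y)"
      "\<forall>j. k < j \<and> j \<le> N \<longrightarrow> \<not> t < avg g (P j x)" "z \<in> P k x" "z \<in> P j y" for k j x y z
  proof -
    have "x \<in> P j z"
      using cell_eq[OF that(5)] self[of x k] cell_mono[of k j z] that(1) by auto
    then have "P j x = P j y"
      using cell_eq that(6) by metis
    then show False using that(1-4) by auto
  qed
  have "C = D" if CD: "C \<in> F" "D \<in> F" and z: "z \<in> C" "z \<in> D" for C D z
  proof -
    obtain k x where C: "C = P k x" "k \<le> N" "t < avg g (P k x)"
        "\<forall>j. k < j \<and> j \<le> N \<longrightarrow> \<not> t < avg g (P j x)"
      using CD(1) by (auto simp: F_def)
    obtain j y where D: "D = P j y" "j \<le> N" "t < avg g (P j y)"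
        "\<forall>i. j < i \<and> i \<le> N \<longrightarrow> \<not> t < avg g (P i y)"
      using CD(2) by (auto simp: F_def)
    have "k = j"
      using aux[of k j y x z] aux[of j k x y z] C D z by force
    then show ?thesis
      using C(1) D(1) z cell_eq by metis
  qed
  then have disj: "disjoint_family_on (\<lambda>C. C) F"
    unfolding disjoint_family_on_def by blast
  have "t * emeasure M E = t * (\<integral>\<^sup>+C. emeasure M C \<partial>count_space F)"
    using emeasure_UN_countable[OF F_sets F disj] by (simp add: E)
  also have "\<dots> = (\<integral>\<^sup>+C. t * emeasure M C \<partial>count_space F)"
    by (simp add: nn_integral_cmult)
  \<comment> \<open>Reading the integrals of \<open>g\<close> as a measure reduces their sum to
    countable additivity.\<close>
  also have "\<dots> \<le> (\<integral>\<^sup>+C. emeasure (density M g) C \<partial>count_space F)"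
    using F_sets by (intro nn_integral_mono)
      (auto simp: emeasure_density F_def intro!: integral_gt_of_avg_gt)
  also have "\<dots> = emeasure (density M g) E"
    using emeasure_UN_countable[of F "\<lambda>C. C" "density M g"] F_sets F disj by (simp add: E)
  also have "\<dots> = (\<integral>\<^sup>+x\<in>E. g x \<partial>M)"
    using F F_sets unfolding E by (intro emeasure_density) (auto intro: sets.countable_Union)
  finally show ?thesis .
qed

text \<open>The truncated sets increase to the full superlevel set, and their bound is uniform in
  \<open>N\<close>.\<close>

lemma weak_type:
  assumes g [measurable]: "g \<in> borel_measurable M"
  shows "t * emeasure M {x. t < maximal g x} \<le> (\<integral>\<^sup>+x. g x \<partial>M)"
proof -
  define E where "E N = {x. \<exists>k\<le>int N. t < avg g (P k x)}" for N
  have "{x. t < maximal g x} = (\<Union>N. E N)"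
  proof (intro equalityI subsetI)
    fix x assume "x \<in> {x. t < maximal g x}"
    then obtain k where "t < avg g (P k x)" by (auto simp: maximal_def less_SUP_iff)
    then have "x \<in> E (nat k)"
      unfolding E_def by (intro CollectI exI[of _ k]) auto
    then show "x \<in> (\<Union>N. E N)" by blast
  qed (auto simp: E_def maximal_def less_SUP_iff)
  moreover have "E N \<in> sets M" for N
  proof -
    have "E N = (\<Union>k\<in>{..int N}. {x \<in> space M. t < avg g (P k x)})"
      by (auto simp: E_def space_UNIV)
    also have "\<dots> \<in> sets M"
      using cell_function_measurable[of "avg g"] by (intro sets.countable_UN') auto
    finally show ?thesis .
  qed
  moreover have "incseq E"
  proof (rule monoI)
    fix m n :: nat assume "m \<le> n"
    then have "int m \<le> int n" by simp
    then show "E m \<subseteq> E n" unfolding E_def by (blast intro: order_trans)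
  qed
  ultimately have "t * emeasure M {x. t < maximal g x} = (SUP N. t * emeasure M (E N))"
    using SUP_emeasure_incseq[of E M] by (simp add: image_subset_iff flip: SUP_mult_left_ennreal)
  also have "\<dots> \<le> (\<integral>\<^sup>+x. g x \<partial>M)"
  proof (rule SUP_least)
    fix N
    have "t * emeasure M (E N) \<le> (\<integral>\<^sup>+x\<in>E N. g x \<partial>M)"
      unfolding E_def by (rule weak_type_truncated) measurable
    also have "\<dots> \<le> (\<integral>\<^sup>+x. g x \<partial>M)"
      by (auto intro!: nn_integral_mono split: split_indicator)
    finally show "t * emeasure M (E N) \<le> (\<integral>\<^sup>+x. g x \<partial>M)" .
  qed
  finally show ?thesis .
qed

section \<open>Strong type by Marcinkiewicz interpolation\<close>

lemma avg_const_le: "avg (\<lambda>_. c) A \<le> c" if "A \<in> sets M"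
proof -
  have "avg (\<lambda>_. c) A = c * emeasure M A / emeasure M A"
    using that by (simp add: avg_def nn_integral_cmult_indicator)
  also have "\<dots> \<le> c"
    \<comment> \<open>Equality fails for cells of measure zero or infinity, whose average is 0 by
      convention.\<close>
    by (cases "emeasure M A = 0"; cases "emeasure M A = top")
       (auto simp: divide_ennreal_def mult_divide_eq_ennreal simp flip: divide_ennreal_def)
  finally show ?thesis .
qed

text \<open>The part of \<open>g\<close> not exceeding \<open>t\<close> contributes at most
  \<open>t\<close> to the maximal function, so above level 2t the part larger than \<open>t\<close>
  must itself have maximal function above \<open>t\<close>.\<close>

lemma weak_type_half:
  assumes g [measurable]: "g \<in> borel_measurable M"
  shows "t * emeasure M {x. 2 * t < maximal g x} \<le> (\<integral>\<^sup>+x. (if t < g x then g x else 0) \<partial>M)"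
proof -
  let ?h = "\<lambda>x. if t < g x then g x else 0"
  have "maximal g x \<le> maximal ?h x + t" for x
    unfolding maximal_def
  proof (rule SUP_least)
    fix k
    have "(\<integral>\<^sup>+y\<in>P k x. g y \<partial>M) \<le> (\<integral>\<^sup>+y\<in>P k x. (?h y + t) \<partial>M)"
      by (intro nn_integral_mono mult_right_mono) (auto simp: not_less)
    also have "\<dots> = (\<integral>\<^sup>+y\<in>P k x. ?h y \<partial>M) + (\<integral>\<^sup>+y\<in>P k x. t \<partial>M)"
      by (intro nn_set_integral_add) auto
    finally have "avg g (P k x) \<le> avg ?h (P k x) + avg (\<lambda>_. t) (P k x)"
      unfolding avg_def add_divide_distrib_ennreal[symmetric] by (rule divide_right_mono_ennreal)
    also have "\<dots> \<le> (SUP k. avg ?h (P k x)) + t"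
      by (intro add_mono SUP_upper avg_const_le) auto
    finally show "avg g (P k x) \<le> (SUP k. avg ?h (P k x)) + t" .
  qed
  then have "{x. 2 * t < maximal g x} \<subseteq> {x \<in> space M. t < maximal ?h x}"
    by (fastforce simp: space_UNIV mult_2 dest: order.strict_trans2)
  moreover have "{x \<in> space M. t < maximal ?h x} \<in> sets M"
    by measurable
  ultimately have "emeasure M {x. 2 * t < maximal g x} \<le> emeasure M {x. t < maximal ?h x}"
    using emeasure_mono by (fastforce simp: space_UNIV)
  then have "t * emeasure M {x. 2 * t < maximal g x} \<le> t * emeasure M {x. t < maximal ?h x}"
    by (rule mult_left_mono) simp
  also have "\<dots> \<le> (\<integral>\<^sup>+x. ?h x \<partial>M)"
    by (intro weak_type) measurable
  finally show ?thesis .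
qed

lemma maximal_strong:
  assumes g [measurable]: "g \<in> borel_measurable M" and p: "1 < p"
  shows "(\<integral>\<^sup>+x. ennpowr (maximal g x) p \<partial>M) \<le>
         ennreal (p * 2 powr p / (p - 1)) * (\<integral>\<^sup>+x. ennpowr (g x) p \<partial>M)"
proof -
  interpret pair_sigma_finite M lborel ..
  have "(\<integral>\<^sup>+x. ennpowr (maximal g x) p \<partial>M) = (\<integral>\<^sup>+x. ennreal p *
     (\<integral>\<^sup>+t. (if 0 < t \<and> ennreal t < maximal g x then ennreal (t powr (p - 1)) else 0) \<partial>lborel) \<partial>M)"
    using p by (simp add: layer_cake)
  also have "\<dots> = ennreal p * (\<integral>\<^sup>+x.
     (\<integral>\<^sup>+t. (if 0 < t \<and> ennreal t < maximal g x then ennreal (t powr (p - 1)) else 0) \<partial>lborel) \<partial>M)"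
    by (intro nn_integral_cmult) measurable
  also have "\<dots> = ennreal p * (\<integral>\<^sup>+t.
     (\<integral>\<^sup>+x. (if 0 < t \<and> ennreal t < maximal g x then ennreal (t powr (p - 1)) else 0) \<partial>M) \<partial>lborel)"
    by (intro arg_cong[where f="(*) _"] Fubini'[symmetric]) measurable
  \<comment> \<open>\<open>weak_type_half\<close> at level t/2. The factor \<open>2 * g x\<close> is
    arranged so that, after a second exchange of integrals, the inner one is
    \<open>layer_cake\<close> with exponent p - 1 at height 2g; this is where p > 1 enters and where
    2^p / (p - 1) comes from.\<close>
  also have "\<dots> \<le> ennreal p * (\<integral>\<^sup>+t. (\<integral>\<^sup>+x.
     2 * g x * (if 0 < t \<and> ennreal t < 2 * g x then ennreal (t powr (p - 1 - 1)) else 0) \<partial>M) \<partial>lborel)"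
  proof (rule mult_left_mono[OF nn_integral_mono])
    fix t :: real
    show "(\<integral>\<^sup>+x. (if 0 < t \<and> ennreal t < maximal g x then ennreal (t powr (p - 1)) else 0) \<partial>M) \<le>
      (\<integral>\<^sup>+x. 2 * g x * (if 0 < t \<and> ennreal t < 2 * g x then ennreal (t powr (p - 1 - 1)) else 0) \<partial>M)"
    proof (cases "0 < t")
      case t: True
      have half: "2 * ennreal (t / 2) = ennreal t"
        using t by (simp flip: ennreal_numeral ennreal_mult)
      have iff: "ennreal (t / 2) < g x \<longleftrightarrow> ennreal t < 2 * g x" for x
        unfolding half[symmetric] by (cases "g x")
          (use t in \<open>auto simp: ennreal_less_iff ennreal_mult_top simp flip: ennreal_numeral ennreal_mult\<close>)
      have meas: "{x. ennreal t < maximal g x} \<in> sets M"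
      proof -
        have "{x \<in> space M. ennreal t < maximal g x} \<in> sets M" by measurable
        then show ?thesis by (simp add: space_UNIV)
      qed
      have "(\<integral>\<^sup>+x. (if 0 < t \<and> ennreal t < maximal g x then ennreal (t powr (p - 1)) else 0) \<partial>M)
         = (\<integral>\<^sup>+x. ennreal (t powr (p - 1)) * indicator {x. ennreal t < maximal g x} x \<partial>M)"
        using t by (intro nn_integral_cong) auto
      also have "\<dots> = ennreal (t powr (p - 1)) * emeasure M {x. ennreal t < maximal g x}"
        by (rule nn_integral_cmult_indicator[OF meas])
      also have "\<dots> = ennreal (2 * t powr (p - 2)) *
         (ennreal (t / 2) * emeasure M {x. 2 * ennreal (t / 2) < maximal g x})"
      proof -
        have "ennreal (t powr (p - 1)) = ennreal (2 * t powr (p - 2)) * ennreal (t / 2)"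
          using t powr_add[of t "p - 2" 1] by (simp flip: ennreal_mult)
        then show ?thesis by (simp add: half mult.assoc)
      qed
      also have "\<dots> \<le> ennreal (2 * t powr (p - 2)) * (\<integral>\<^sup>+x. (if ennreal (t / 2) < g x then g x else 0) \<partial>M)"
        by (intro mult_left_mono weak_type_half) auto
      also have "\<dots> = (\<integral>\<^sup>+x. ennreal (2 * t powr (p - 2)) * (if ennreal (t / 2) < g x then g x else 0) \<partial>M)"
        by (intro nn_integral_cmult[symmetric]) measurable
      also have "\<dots> =
         (\<integral>\<^sup>+x. 2 * g x * (if 0 < t \<and> ennreal t < 2 * g x then ennreal (t powr (p - 1 - 1)) else 0) \<partial>M)"
        using t by (intro nn_integral_cong) (auto simp: iff ennreal_mult mult_ac)
      finally show ?thesis .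
    qed simp
  qed auto
  also have "\<dots> = ennreal p * (\<integral>\<^sup>+x. (\<integral>\<^sup>+t.
     2 * g x * (if 0 < t \<and> ennreal t < 2 * g x then ennreal (t powr (p - 1 - 1)) else 0) \<partial>lborel) \<partial>M)"
    by (intro arg_cong[where f="(*) _"] Fubini') measurable
  also have "\<dots> = ennreal p * (\<integral>\<^sup>+x. 2 * g x * (\<integral>\<^sup>+t.
     (if 0 < t \<and> ennreal t < 2 * g x then ennreal (t powr (p - 1 - 1)) else 0) \<partial>lborel) \<partial>M)"
    by (intro arg_cong[where f="(*) _"] nn_integral_cong nn_integral_cmult) measurable
  also have "\<dots> = ennreal p * (\<integral>\<^sup>+x. ennreal (2 powr p / (p - 1)) * ennpowr (g x) p \<partial>M)"
  proof -
    have "2 * g x * (\<integral>\<^sup>+t.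
     (if 0 < t \<and> ennreal t < 2 * g x then ennreal (t powr (p - 1 - 1)) else 0) \<partial>lborel) =
       ennreal (2 powr p / (p - 1)) * ennpowr (g x) p" (is "2 * g x * ?I = _") for x
    proof -
      have I: "?I = ennreal (1 / (p - 1)) * ennpowr (2 * g x) (p - 1)"
      proof -
        have "ennreal (1 / (p - 1)) * (ennreal (p - 1) * ?I) =
              (ennreal (1 / (p - 1)) * ennreal (p - 1)) * ?I"
          by (rule mult.assoc[symmetric])
        also have "ennreal (1 / (p - 1)) * ennreal (p - 1) = 1"
          using p by (simp flip: ennreal_mult)
        finally show ?thesis
          using p layer_cake[of "p - 1" "2 * g x"] by simp
      qed
      have "2 * g x * ?I = ennreal (1 / (p - 1)) * (ennpowr (2 * g x) 1 * ennpowr (2 * g x) (p - 1))"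
        unfolding I ennpowr_one by (rule mult.left_commute)
      also have "\<dots> = ennreal (1 / (p - 1)) * ennpowr (2 * g x) p"
        using p ennpowr_add[of 1 "p - 1" "2 * g x"] by simp
      also have "ennpowr (2 * g x) p = ennreal (2 powr p) * ennpowr (g x) p"
        using p by (simp add: ennpowr_mult ennpowr_ennreal flip: ennreal_numeral)
      also have "ennreal (1 / (p - 1)) * \<dots> = ennreal (2 powr p / (p - 1)) * ennpowr (g x) p"
        using p by (simp add: mult.assoc[symmetric] flip: ennreal_mult)
      finally show ?thesis .
    qed
    then show ?thesis by simp
  qed
  also have "\<dots> = ennreal p * (ennreal (2 powr p / (p - 1)) * (\<integral>\<^sup>+x. ennpowr (g x) p \<partial>M))"
    using p by (subst nn_integral_cmult) measurable
  also have "\<dots> = ennreal (p * 2 powr p / (p - 1)) * (\<integral>\<^sup>+x. ennpowr (g x) p \<partial>M)"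
    using p by (simp add: mult.assoc[symmetric] flip: ennreal_mult)
  finally show ?thesis .
qed

text \<open>A Hedberg-type interpolation. On a cell of measure s with average y, the fractional
  average is y s^(1-a). Since (1-a) q = q/p - 1, its q-th power is y^p (y^p s)^(q/p-1), and Hoelder
  bounds y^p s by the full integral of g^p.\<close>

lemma frac_max_le:
  assumes g [measurable]: "g \<in> borel_measurable M" and p: "1 < p" "p < q"
    and a: "a = 1 - (1 / p - 1 / q)" and F: "(\<integral>\<^sup>+x. ennpowr (g x) p \<partial>M) \<noteq> top"
  shows "ennpowr (frac_max a g x) q \<le>
         ennpowr (\<integral>\<^sup>+x. ennpowr (g x) p \<partial>M) (q / p - 1) * ennpowr (maximal g x) p"
    (is "_ \<le> ennpowr ?F _ * _")
proof -
  have "1 / p < 1" "0 < 1 / q"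
    using p by auto
  then have a0: "0 < a"
    unfolding a by linarith
  obtain f where f: "?F = ennreal f" "0 \<le> f"
    using F by (cases ?F) auto
  have "frac_max a g x \<le> ennpowr (ennpowr ?F (q / p - 1) * ennpowr (maximal g x) p) (1 / q)"
    unfolding frac_max_def
  proof (rule SUP_least)
    fix k
    let ?A = "P k x"
    let ?I = "\<integral>\<^sup>+y\<in>?A. g y \<partial>M"
    consider "emeasure M ?A = 0" | "emeasure M ?A = top" | s where "emeasure M ?A = ennreal s" "0 < s"
      by (cases "emeasure M ?A") force+
    then show "?I / ennpowr (emeasure M ?A) a \<le>
        ennpowr (ennpowr ?F (q / p - 1) * ennpowr (maximal g x) p) (1 / q)"
    proof cases
      case 1
      then have "?I = 0"
        using nn_integral_null_set[of ?A M g] by (simp add: null_sets_def)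
      then show ?thesis by simp
    next
      case 2
      then show ?thesis using a0 by (simp add: divide_ennreal_def)
    next
      case 3
      have "ennpowr ?I p \<le> (\<integral>\<^sup>+y\<in>?A. ennpowr (g y) p \<partial>M) * ennpowr (emeasure M ?A) (p - 1)"
        using 3 p by (intro ennpowr_nn_set_integral_le) auto
      also have "\<dots> \<le> ?F * ennpowr (emeasure M ?A) (p - 1)"
        by (intro mult_right_mono nn_integral_mono) (auto split: split_indicator)
      also have "\<dots> = ennreal (f * s powr (p - 1))"
        using 3 p f by (simp add: ennpowr_ennreal ennreal_mult)
      finally have le: "ennpowr ?I p \<le> ennreal (f * s powr (p - 1))" .
      then have "?I \<noteq> top"
        using p by (auto simp: top_unique)
      then obtain i where i: "?I = ennreal i" "0 \<le> i"
        by (cases ?I) auto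
      then have ip: "i powr p \<le> f * s powr (p - 1)"
        using le p f by (simp add: ennpowr_ennreal)
      define y where "y = i / s"
      have y: "0 \<le> y" "i = y * s"
        using i 3 by (auto simp: y_def)
      have "y powr p * s powr p \<le> f * s powr (p - 1)"
        using ip y 3 by (simp add: powr_mult)
      then have "(y powr p * s) * s powr (p - 1) \<le> f * s powr (p - 1)"
        using 3 powr_add[of s 1 "p - 1"] by (simp add: mult_ac)
      then have yp: "y powr p * s \<le> f"
        using 3 by simp
      have "(i / s powr a) powr q = y powr p * (y powr p * s) powr (q / p - 1)"
      proof (cases "y = 0")
        case False
        then have "0 < y" using y by simp
        have "i / s powr a = y * s powr (1 - a)"
          using y 3 by (simp add: powr_diff)
        then have "(i / s powr a) powr q = y powr q * s powr ((1 - a) * q)"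
          using y by (simp add: powr_mult powr_powr)
        also have "(1 - a) * q = q / p - 1"
          using p by (simp add: a field_simps)
        also have "y powr q = y powr p * y powr (p * (q / p - 1))"
          using p \<open>0 < y\<close> by (simp add: powr_add[symmetric] field_simps)
        finally show ?thesis
          by (simp add: powr_mult powr_powr)
      qed (use y p in simp)
      also have "\<dots> \<le> y powr p * f powr (q / p - 1)"
        using yp p y 3 by (intro mult_left_mono powr_mono2) (auto simp: field_simps)
      finally have "((i / s powr a) powr q) powr (1 / q) \<le> (f powr (q / p - 1) * y powr p) powr (1 / q)"
        using p by (intro powr_mono2) (auto simp: mult_ac)
      then have "i / s powr a \<le> (f powr (q / p - 1) * y powr p) powr (1 / q)"
        using p i by (simp add: powr_powr)
      then have "?I / ennpowr (emeasure M ?A) a \<le> ennreal ((f powr (q / p - 1) * y powr p) powr (1 / q))"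
        using i 3 a0 by (simp add: ennpowr_ennreal divide_ennreal ennreal_leI)
      also have "\<dots> = ennpowr (ennpowr ?F (q / p - 1) * ennpowr (ennreal y) p) (1 / q)"
        using f y p by (simp add: ennpowr_ennreal field_simps flip: ennreal_mult)
      also have "ennreal y = avg g ?A"
        using i 3 by (simp add: avg_def y_def divide_ennreal)
      also have "ennpowr (ennpowr ?F (q / p - 1) * ennpowr (avg g ?A) p) (1 / q) \<le>
            ennpowr (ennpowr ?F (q / p - 1) * ennpowr (maximal g x) p) (1 / q)"
        using p unfolding maximal_def
        by (intro ennpowr_mono mult_left_mono SUP_upper) auto
      finally show ?thesis .
    qed
  qed
  then have "ennpowr (frac_max a g x) q \<le>
      ennpowr (ennpowr (ennpowr ?F (q / p - 1) * ennpowr (maximal g x) p) (1 / q)) q"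
    using p by (intro ennpowr_mono) auto
  then show ?thesis
    using p by (simp add: ennpowr_ennpowr)
qed

text \<open>Integrate the pointwise bound and apply \<open>maximal_strong\<close>. For p = q the
  interpolation exponent q/p - 1 vanishes, but then a = 1 and the operator is the ordinary maximal
  function.\<close>

lemma frac_max_strong:
  assumes g [measurable]: "g \<in> borel_measurable M" and p: "1 < p" "p \<le> q"
    and a: "a = 1 - (1 / p - 1 / q)"
  shows "(\<integral>\<^sup>+x. ennpowr (frac_max a g x) q \<partial>M) \<le>
         ennreal (p * 2 powr p / (p - 1)) * ennpowr (\<integral>\<^sup>+x. ennpowr (g x) p \<partial>M) (q / p)"
proof -
  let ?F = "\<integral>\<^sup>+x. ennpowr (g x) p \<partial>M" and ?C = "ennreal (p * 2 powr p / (p - 1))"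
  have C: "?C \<noteq> 0"
    using p by simp
  consider "p = q" | "p < q" "?F = top" | "p < q" "?F \<noteq> top"
    using p by fastforce
  then show ?thesis
  proof cases
    case 1
    then have "frac_max a g = maximal g"
      by (simp add: a frac_max_def maximal_def avg_def fun_eq_iff)
    then show ?thesis
      using maximal_strong[OF g, of p] 1 p by simp
  next
    case 2
    then show ?thesis
      using p C by (simp add: ennreal_mult_top)
  next
    case 3
    have "(\<integral>\<^sup>+x. ennpowr (frac_max a g x) q \<partial>M) \<le>
          (\<integral>\<^sup>+x. ennpowr ?F (q / p - 1) * ennpowr (maximal g x) p \<partial>M)"
      using 3 p a by (intro nn_integral_mono frac_max_le) auto
    also have "\<dots> = ennpowr ?F (q / p - 1) * (\<integral>\<^sup>+x. ennpowr (maximal g x) p \<partial>M)"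
      using p by (intro nn_integral_cmult) measurable
    also have "\<dots> \<le> ennpowr ?F (q / p - 1) * (?C * ?F)"
      using p by (intro mult_left_mono maximal_strong) auto
    also have "\<dots> = ?C * (ennpowr ?F (q / p - 1) * ennpowr ?F 1)"
      by (simp add: mult_ac)
    also have "ennpowr ?F (q / p - 1) * ennpowr ?F 1 = ennpowr ?F (q / p)"
      using p 3 ennpowr_add[of "q / p - 1" 1 ?F] by (simp add: field_simps)
    finally show ?thesis .
  qed
qed

end

section \<open>Shifted dyadic grids\<close>

text \<open>The sign alternates with the scale because \<open>2 / 3 = 1 - 1 / 3\<close>: this makes the shifted grid nested.\<close>

definition grid_shift :: "bool \<Rightarrow> int \<Rightarrow> real" where
  "grid_shift e k = (if e then (if even k then 1 / 3 else - 1 / 3) else 0)"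

definition grid_index :: "('n \<Rightarrow> bool) \<Rightarrow> int \<Rightarrow> real ^ 'n \<Rightarrow> 'n \<Rightarrow> int" where
  "grid_index e k x i = \<lfloor>x $ i / 2 powi k - grid_shift (e i) k\<rfloor>"

definition cell :: "('n \<Rightarrow> bool) \<Rightarrow> int \<Rightarrow> real ^ 'n \<Rightarrow> (real ^ 'n) set" where
  "cell e k x = {y. grid_index e k y = grid_index e k x}"

text \<open>With s_k the shift at scale k, 2 s_(k+1) - s_k is the integer \<open>?c\<close> below.
  Hence the index of a point at scale k determines its index at scale k + 1, which is
  nestedness.\<close>

lemma grid_index_step:
  "grid_index e (k + 1) x i =
     (grid_index e k x i - (if e i then (if even k then - 1 else 1) else 0)) div 2"
proof -
  define z where "z = x $ i / 2 powi (k + 1) - grid_shift (e i) (k + 1)"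
  let ?c = "if e i then (if even k then - 1 else 1) else (0 :: int)"
  have "x $ i / 2 powi k - grid_shift (e i) k = 2 * z + of_int ?c"
    by (simp add: z_def power_int_add grid_shift_def field_simps)
  then have "grid_index e k x i - ?c = \<lfloor>2 * z\<rfloor>"
    by (simp only: grid_index_def floor_add_int[symmetric])
  moreover have "\<lfloor>z\<rfloor> = \<lfloor>2 * z\<rfloor> div 2"
    using floor_divide_real_eq_div[of 2 "2 * z"] by simp
  ultimately show ?thesis
    by (simp add: grid_index_def z_def)
qed

lemma cell_step: "cell e k x \<subseteq> cell e (k + 1) x"
  by (auto simp: cell_def fun_eq_iff grid_index_step)

lemma countable_range_cell: "countable (range (cell e k))" for e :: "'n::finite \<Rightarrow> bool"
proof -
  have "range (cell e k) \<subseteq> range (\<lambda>m. {y. grid_index e k y = m})"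
    by (auto simp: cell_def)
  then show ?thesis
    by (rule countable_subset) simp
qed

lemma cell_borel: "cell e k x \<in> sets borel"
proof -
  have "cell e k x = (\<Inter>i. {y. real_of_int (grid_index e k x i) \<le> y $ i / 2 powi k - grid_shift (e i) k} \<inter>
      {y. y $ i / 2 powi k - grid_shift (e i) k < real_of_int (grid_index e k x i) + 1})"
    unfolding cell_def fun_eq_iff grid_index_def by (auto simp: floor_eq_iff)
  also have "\<dots> \<in> sets borel"
    by (intro sets.finite_INT sets.Int borel_closed borel_open closed_Collect_le open_Collect_less
        continuous_intros) auto
  finally show ?thesis .
qed

lemma sigma_finite_lebesgue: "sigma_finite_measure (lebesgue :: 'a::euclidean_space measure)"
proof -
  obtain A :: "'a set set" where "countable A" "A \<subseteq> sets lborel" "\<Union>A = space lborel"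
      "\<forall>a\<in>A. emeasure lborel a \<noteq> \<infinity>"
    using lborel.sigma_finite_countable by metis
  then show ?thesis
    by (intro sigma_finite_measure.intro exI[of _ A]) auto
qed

text \<open>A real-valued density keeps the measure sigma-finite even where \<open>u\<close> fails
  to be locally integrable.\<close>

lemma nested_partition_cell:
  fixes e :: "'n::finite \<Rightarrow> bool"
  assumes [measurable]: "u \<in> borel_measurable lebesgue"
  shows "nested_partition (density lebesgue (\<lambda>x. ennreal (u x))) (cell e)"
proof -
  interpret sigma_finite_measure "lebesgue :: (real ^ 'n) measure"
    by (rule sigma_finite_lebesgue)
  have "sigma_finite_measure (density lebesgue (\<lambda>x. ennreal (u x)))"
    by (subst sigma_finite_iff_density_finite) auto
  moreover have "cell e k x \<in> sets lebesgue" for k x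
    using cell_borel by (intro sets_completionI_sets) simp
  ultimately show ?thesis
  proof (intro nested_partition.intro nested_partition_axioms.intro)
    show "countable (range (cell e k))" for k
      by (rule countable_range_cell)
    show "cell e k x \<subseteq> cell e (k + 1) x" for k x
      by (rule cell_step)
    show "x \<in> cell e k x" for k x
      by (simp add: cell_def)
    show "cell e k y = cell e k x" if "y \<in> cell e k x" for k x y
      using that by (simp add: cell_def)
  qed auto
qed

text \<open>The one-third trick on a line. Otherwise (a, b] contains both an integer and an integer
  plus s. Their distance is below 1/3, so some integer lies within less than 1/3 of s, which is
  impossible for s = 1/3 or s = -1/3.\<close>

lemma floor_eq_or_shifted_floor_eq:
  fixes a b s :: real
  assumes "a \<le> b" "b - a \<le> 1 / 3" "\<bar>s\<bar> = 1 / 3"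
  shows "\<lfloor>a\<rfloor> = \<lfloor>b\<rfloor> \<or> \<lfloor>a - s\<rfloor> = \<lfloor>b - s\<rfloor>"
proof (rule ccontr)
  assume "\<not> ?thesis"
  then have "\<lfloor>a\<rfloor> < \<lfloor>b\<rfloor>" "\<lfloor>a - s\<rfloor> < \<lfloor>b - s\<rfloor>"
    using assms floor_mono[of a b] floor_mono[of "a - s" "b - s"] by auto
  then have "a < \<lfloor>b\<rfloor>" "a - s < \<lfloor>b - s\<rfloor>"
    by (simp_all add: floor_less_iff)
  moreover have "\<lfloor>b\<rfloor> \<le> b" "\<lfloor>b - s\<rfloor> \<le> b - s"
    by simp_all
  moreover define m where "m = \<lfloor>b\<rfloor> - \<lfloor>b - s\<rfloor>"
  ultimately have "\<bar>real_of_int m - s\<bar> < 1 / 3"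
    using assms by (simp only: of_int_diff m_def)
  then have "(0 < real_of_int m \<and> real_of_int m < 1) \<or> (- 1 < real_of_int m \<and> real_of_int m < 0)"
    using assms(3) by argo
  then show False
    by auto
qed

lemma mem_cube: "y \<in> cube c l \<longleftrightarrow> (\<forall>i. \<bar>y $ i - c $ i\<bar> \<le> l / 2)"
proof -
  have "y \<in> cube c l \<longleftrightarrow> (\<forall>i. c $ i - l / 2 \<le> y $ i \<and> y $ i \<le> c $ i + l / 2)"
    by (simp add: cube_def mem_box_cart)
  also have "\<dots> \<longleftrightarrow> (\<forall>i. \<bar>y $ i - c $ i\<bar> \<le> l / 2)"
    by (intro all_cong1) argo
  finally show ?thesis .
qed

text \<open>The shift is chosen in each coordinate separately, which is why 2^n grids are
  needed.\<close>

lemma cube_subset_cell_subset_cube: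
  fixes c :: "real ^ 'n::finite"
  assumes l: "0 < l"
  obtains e k where "cube c l \<subseteq> cell e k c" "cell e k c \<subseteq> cube c (12 * l)"
proof -
  \<comment> \<open>The least power of two that is at least 3l: the side of the cube is at most a
    third of the cell's, and the cell, of side below 6l and containing \<open>c\<close>, stays
    within 6l = 12l/2 of \<open>c\<close>.\<close>
  define k where "k = \<lceil>log 2 (3 * l)\<rceil>"
  have "2 powr (log 2 (3 * l)) \<le> 2 powr real_of_int k"
    unfolding k_def by (intro powr_mono) auto
  then have k1: "3 * l \<le> 2 powi k"
    using l by (simp add: powr_real_of_int')
  have "2 powr (real_of_int k - 1) < 2 powr (log 2 (3 * l))"
    unfolding k_def by (intro powr_less_mono) linarith+
  then have k2: "2 powi k < 6 * l"
    using l by (simp add: powr_diff powr_real_of_int')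
  define D where "D = (2 :: real) powi k"
  have D: "0 < D" "3 * l \<le> D" "D < 6 * l"
    using k1 k2 by (simp_all add: D_def)
  let ?s = "grid_shift True k"
  have s: "\<bar>?s\<bar> = 1 / 3" "grid_shift False k = 0"
    by (simp_all add: grid_shift_def)
  define e where "e i \<longleftrightarrow> \<lfloor>(c $ i - l / 2) / D\<rfloor> \<noteq> \<lfloor>(c $ i + l / 2) / D\<rfloor>" for i
  have ends: "\<lfloor>(c $ i - l / 2) / D - grid_shift (e i) k\<rfloor> = \<lfloor>(c $ i + l / 2) / D - grid_shift (e i) k\<rfloor>" for i
    using floor_eq_or_shifted_floor_eq[of "(c $ i - l / 2) / D" "(c $ i + l / 2) / D" ?s] D l s
    by (cases "e i") (auto simp: e_def field_simps)
  have index: "grid_index e k y i = \<lfloor>(c $ i - l / 2) / D - grid_shift (e i) k\<rfloor>"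
    if "y \<in> cube c l" for y i
  proof -
    have "c $ i - l / 2 \<le> y $ i" "y $ i \<le> c $ i + l / 2"
      using that[unfolded mem_cube, rule_format, of i] by argo+
    then have "(c $ i - l / 2) / D - grid_shift (e i) k \<le> y $ i / D - grid_shift (e i) k"
      "y $ i / D - grid_shift (e i) k \<le> (c $ i + l / 2) / D - grid_shift (e i) k"
      using D by (auto intro!: divide_right_mono)
    then show ?thesis
      using ends[of i] unfolding grid_index_def D_def[symmetric]
      by (intro order_antisym) (metis floor_mono)+
  qed
  have "c \<in> cube c l"
    using l by (simp add: mem_cube)
  then have "cube c l \<subseteq> cell e k c"
    using index by (auto simp: cell_def fun_eq_iff)
  moreover have "cell e k c \<subseteq> cube c (12 * l)"
    unfolding mem_cube subset_iff
  proof (intro allI impI)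
    fix y i assume "y \<in> cell e k c"
    then have "grid_index e k y i = grid_index e k c i"
      by (simp add: cell_def)
    then have "\<bar>y $ i / D - c $ i / D\<bar> < 1"
      unfolding grid_index_def D_def[symmetric] by linarith
    then have "\<bar>y $ i - c $ i\<bar> < D"
      using D by (simp add: diff_divide_distrib[symmetric] pos_divide_less_eq)
    then show "\<bar>y $ i - c $ i\<bar> \<le> 12 * l / 2"
      using D by simp
  qed
  ultimately show ?thesis
    using that by blast
qed

lemma cube_vol_eq: "0 < l \<Longrightarrow> cube_vol (c :: real ^ 'n) l = ennreal (l ^ CARD('n))"
proof -
  assume l: "0 < l"
  have "cbox (\<chi> i. c $ i - l / 2) (\<chi> i. c $ i + l / 2) \<noteq> {}"
    using l mem_cube[of c c l] by (auto simp: cube_def)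
  then have "measure lborel (cube c l) = l ^ CARD('n)"
    unfolding cube_def by (simp add: content_cbox_cart)
  then show ?thesis
    unfolding cube_vol_def cube_def
    using emeasure_lborel_cbox_finite[of "\<chi> i. c $ i - l / 2" "\<chi> i. c $ i + l / 2"]
    by (simp add: emeasure_eq_ennreal_measure less_top[symmetric])
qed

section \<open>Two-weight estimates\<close>

lemma weight_measurable:
  fixes w :: "real ^ 'n \<Rightarrow> real"
  assumes "weight w"
  shows "w \<in> borel_measurable lebesgue"
proof (rule borel_measurable_LIMSEQ_real)
  fix k :: nat
  have "w absolutely_integrable_on (cball 0 (real k))"
    using assms by (simp add: weight_def locally_integrable_def)
  then show "(\<lambda>x. indicator (cball 0 (real k)) x *\<^sub>R w x) \<in> borel_measurable lebesgue"
    unfolding set_integrable_def by (rule borel_measurable_integrable)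
next
  fix x :: "real ^ 'n"
  have "eventually (\<lambda>k. norm x \<le> real k) sequentially"
    by real_asymp
  then show "(\<lambda>k. indicator (cball 0 (real k)) x *\<^sub>R w x) \<longlonglongrightarrow> w x"
    by (intro tendsto_eventually) (erule eventually_mono, simp)
qed

lemma ennreal_factors_finite:
  fixes x y :: ennreal
  assumes "x * y < top" "0 < x" "0 < y"
  shows "x < top" "y < top"
  using assms by (metis ennreal_mult_eq_top_iff less_irrefl top.not_eq_extremum)+

lemma nn_set_integral_density:
  assumes "u \<in> borel_measurable M" "g \<in> borel_measurable M" "A \<in> sets M"
  shows "(\<integral>\<^sup>+x\<in>A. g x \<partial>density M u) = (\<integral>\<^sup>+x\<in>A. u x * g x \<partial>M)"
  using assms by (subst nn_integral_density) (auto simp: mult.assoc)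

text \<open>\<open>\<alpha>\<close> does not occur: the exponent 1 - \<alpha>/n is expressed through
  \<open>p\<close> and \<open>q\<close> as \<open>a\<close>. The class constant enters as a real
  \<open>A\<close>, so that powers of it are ordinary real powers.\<close>

locale Apq_weight =
  fixes V :: "real ^ 'n \<Rightarrow> real" and \<theta> p q A :: real and w :: "real ^ 'n \<Rightarrow> real"
  assumes \<theta>: "0 < \<theta>" and p: "1 < p" and pq: "p \<le> q" and w: "weight w" and A0: "0 \<le> A"
    and A: "Apq_const V (\<theta> / (1 + conj_exponent p / q) / 3) p q w = ennreal A"
begin

definition "p' = conj_exponent p"
definition "\<kappa> = 1 + p' / q"
definition "a = 1 - (1 / p - 1 / q)"
definition "b = a * p' / q"
definition "u x = w x powr q"
definition "\<sigma> x = w x powr (- p')"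
definition "U = density lebesgue (\<lambda>x. ennreal (u x))"
definition "S = density lebesgue (\<lambda>x. ennreal (\<sigma> x))"

text \<open>All rest on 1 - 1/p = 1/p', that is, a = 1/p' + 1/q.\<close>

lemma exponents: "1 < q" "0 < p'" "1 < \<kappa>" "0 < a" "0 < b" "p' * a = \<kappa>" "b * q = \<kappa>" "p' * (p - 1) = p"
proof -
  show q: "1 < q" using p pq by simp
  show p': "0 < p'" using p by (simp add: p'_def conj_exponent_def)
  show "1 < \<kappa>" using q p' by (simp add: \<kappa>_def)
  show e: "p' * (p - 1) = p" using p by (simp add: p'_def conj_exponent_def)
  have "1 / p < 1" "0 < 1 / q" using p q by auto
  then show a: "0 < a" unfolding a_def by linarith
  then show "0 < b" using p' q by (simp add: b_def)
  show k: "p' * a = \<kappa>" using p q by (simp add: \<kappa>_def a_def p'_def conj_exponent_def field_simps)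
  then show "b * q = \<kappa>" using q by (simp add: b_def mult.commute)
qed

lemma w_meas [measurable]: "w \<in> borel_measurable lebesgue"
  using w by (rule weight_measurable)

lemma u_meas [measurable]: "u \<in> borel_measurable lebesgue"
  and \<sigma>_meas [measurable]: "\<sigma> \<in> borel_measurable lebesgue"
  unfolding u_def [abs_def] \<sigma>_def [abs_def] by measurable

lemma w_pos: "AE x in lebesgue. 0 < w x"
  using w by (simp add: weight_def)

sublocale U: nested_partition U "cell e" for e :: "'n \<Rightarrow> bool"
  unfolding U_def by (rule nested_partition_cell) measurable

sublocale S: nested_partition S "cell e" for e :: "'n \<Rightarrow> bool"
  unfolding S_def by (rule nested_partition_cell) measurable

lemma sets_US [simp, measurable_cong]: "sets U = sets lebesgue" "sets S = sets lebesgue"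
  by (simp_all add: U_def S_def)

lemma cell_lebesgue [measurable, simp]: "cell (e :: 'n \<Rightarrow> bool) k x \<in> sets lebesgue"
  using U.cell_sets by simp

lemma emeasure_U: "B \<in> sets lebesgue \<Longrightarrow> emeasure U B = (\<integral>\<^sup>+y\<in>B. ennreal (u y) \<partial>lebesgue)"
  by (simp add: U_def emeasure_density)

lemma emeasure_S: "B \<in> sets lebesgue \<Longrightarrow> emeasure S B = (\<integral>\<^sup>+y\<in>B. ennreal (\<sigma> y) \<partial>lebesgue)"
  by (simp add: S_def emeasure_density)

lemma emeasure_pos:
  assumes B [measurable]: "B \<in> sets lebesgue" and pos: "0 < emeasure lebesgue B"
  shows "0 < emeasure U B" "0 < emeasure S B"
proof -
  have *: "0 < (\<integral>\<^sup>+y\<in>B. ennreal (w y powr c) \<partial>lebesgue)" for c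
  proof (rule ccontr)
    assume "\<not> ?thesis"
    then have "(\<integral>\<^sup>+y\<in>B. ennreal (w y powr c) \<partial>lebesgue) = 0" by simp
    then have "AE y in lebesgue. ennreal (w y powr c) * indicator B y = 0"
      by (subst (asm) nn_integral_0_iff_AE) auto
    with w_pos have "AE y in lebesgue. y \<notin> B"
      by eventually_elim (auto simp: indicator_def split: if_splits)
    then have "emeasure lebesgue B = 0"
      using AE_iff_measurable[OF B, of "\<lambda>y. y \<notin> B"] by simp
    then show False using pos by simp
  qed
  show "0 < emeasure U B" "0 < emeasure S B"
    using *[of q] *[of "- p'"] by (simp_all add: emeasure_U emeasure_S u_def \<sigma>_def)
qed

text \<open>Here \<open>1 / u = 0\<close> and \<open>\<bar>f\<bar> / \<sigma> = 0\<close> where \<open>w = 0\<close>, a null set.\<close>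

definition G :: "('n \<Rightarrow> bool) \<Rightarrow> (real ^ 'n \<Rightarrow> real) \<Rightarrow> real ^ 'n \<Rightarrow> ennreal" where
  "G e f = S.frac_max e a (\<lambda>y. ennreal (\<bar>f y\<bar> / \<sigma> y))"

text \<open>The exponent \<open>q / \<kappa>\<close> is 1/b, because
  \<open>b * q = \<kappa>\<close>.\<close>

definition H :: "('n \<Rightarrow> bool) \<Rightarrow> (real ^ 'n \<Rightarrow> real) \<Rightarrow> real ^ 'n \<Rightarrow> ennreal" where
  "H e f = U.maximal e (\<lambda>y. ennpowr (G e f y) (q / \<kappa>) * ennreal (1 / u y))"

lemma G_meas [measurable]: "G e f \<in> borel_measurable lebesgue"
  using S.frac_max_measurable unfolding G_def by (simp cong: measurable_cong_sets)

lemma H_meas [measurable]: "H e f \<in> borel_measurable lebesgue"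
  using U.maximal_measurable unfolding H_def by (simp cong: measurable_cong_sets)

lemma S_integral:
  assumes [measurable]: "f \<in> borel_measurable lebesgue" "B \<in> sets lebesgue"
  shows "(\<integral>\<^sup>+y\<in>B. ennreal (\<bar>f y\<bar> / \<sigma> y) \<partial>S) = (\<integral>\<^sup>+y\<in>B. ennreal \<bar>f y\<bar> \<partial>lebesgue)"
proof -
  have "(\<integral>\<^sup>+y\<in>B. ennreal (\<bar>f y\<bar> / \<sigma> y) \<partial>S) = (\<integral>\<^sup>+y\<in>B. ennreal (\<sigma> y) * ennreal (\<bar>f y\<bar> / \<sigma> y) \<partial>lebesgue)"
    unfolding S_def by (intro nn_set_integral_density) measurable
  also have "\<dots> = (\<integral>\<^sup>+y\<in>B. ennreal \<bar>f y\<bar> \<partial>lebesgue)"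
    using w_pos by (intro nn_integral_cong_AE) (auto elim!: eventually_mono simp: \<sigma>_def simp flip: ennreal_mult)
  finally show ?thesis .
qed

lemma U_integral:
  assumes [measurable]: "g \<in> borel_measurable lebesgue" "B \<in> sets lebesgue"
  shows "(\<integral>\<^sup>+y\<in>B. g y * ennreal (1 / u y) \<partial>U) = (\<integral>\<^sup>+y\<in>B. g y \<partial>lebesgue)"
proof -
  have "(\<integral>\<^sup>+y\<in>B. g y * ennreal (1 / u y) \<partial>U) = (\<integral>\<^sup>+y\<in>B. ennreal (u y) * (g y * ennreal (1 / u y)) \<partial>lebesgue)"
    unfolding U_def by (intro nn_set_integral_density) measurable
  also have "\<dots> = (\<integral>\<^sup>+y\<in>B. g y \<partial>lebesgue)"
    using w_pos by (intro nn_integral_cong_AE)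
      (auto elim!: eventually_mono simp: u_def mult.left_commute[of _ "g _"] simp flip: ennreal_mult)
  finally show ?thesis .
qed

text \<open>Two maximal bounds in a row: \<open>U.maximal_strong\<close> with exponent
  \<open>\<kappa>\<close>, then \<open>S.frac_max_strong\<close> from p to q. The weights are
  converted in between and at the end.\<close>

lemma H_strong:
  assumes f [measurable]: "f \<in> borel_measurable lebesgue"
  shows "(\<integral>\<^sup>+x. ennreal (u x) * ennpowr (H e f x) \<kappa> \<partial>lebesgue) \<le>
     ennreal (\<kappa> * 2 powr \<kappa> / (\<kappa> - 1)) * (ennreal (p * 2 powr p / (p - 1)) *
       ennpowr (\<integral>\<^sup>+x. ennpowr (ennreal \<bar>f x\<bar>) p * ennreal (w x powr p) \<partial>lebesgue) (q / p))"
proof -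
  note ex = exponents
  let ?C = "ennreal (\<kappa> * 2 powr \<kappa> / (\<kappa> - 1))"
  have "(\<integral>\<^sup>+x. ennreal (u x) * ennpowr (H e f x) \<kappa> \<partial>lebesgue) = (\<integral>\<^sup>+x. ennpowr (H e f x) \<kappa> \<partial>U)"
    using ex unfolding U_def by (intro nn_integral_density[symmetric]) measurable
  also have "\<dots> \<le> ?C * (\<integral>\<^sup>+y. ennpowr (ennpowr (G e f y) (q / \<kappa>) * ennreal (1 / u y)) \<kappa> \<partial>U)"
    using ex unfolding H_def by (intro U.maximal_strong) measurable
  also have "(\<integral>\<^sup>+y. ennpowr (ennpowr (G e f y) (q / \<kappa>) * ennreal (1 / u y)) \<kappa> \<partial>U) =
     (\<integral>\<^sup>+y. ennreal (u y) * ennpowr (ennpowr (G e f y) (q / \<kappa>) * ennreal (1 / u y)) \<kappa> \<partial>lebesgue)"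
    using ex unfolding U_def by (intro nn_integral_density) measurable
  also have "\<dots> = (\<integral>\<^sup>+y. ennreal (\<sigma> y) * ennpowr (G e f y) q \<partial>lebesgue)"
  proof (rule nn_integral_cong_AE)
    have *: "ennreal (u y) * ennpowr (ennpowr (G e f y) (q / \<kappa>) * ennreal (1 / u y)) \<kappa> =
       ennreal (\<sigma> y) * ennpowr (G e f y) q" if y: "0 < w y" for y
    proof -
      have "u y * (1 / u y) powr \<kappa> = \<sigma> y"
      proof -
        have "u y * (1 / u y) powr \<kappa> = w y powr q * w y powr (- (q * \<kappa>))"
          using y by (simp add: u_def powr_divide powr_powr powr_minus field_simps)
        also have "\<dots> = w y powr (q - q * \<kappa>)"
          by (simp add: powr_add[symmetric])
        \<comment> \<open>From \<open>\<kappa>\<close> - 1 = p'/q: the powers of \<open>u\<close>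
          left by the first bound form exactly the density of \<open>S\<close>.\<close>
        also have "q - q * \<kappa> = - p'"
          using ex by (simp add: \<kappa>_def field_simps)
        finally show ?thesis by (simp add: \<sigma>_def)
      qed
      moreover have "ennpowr (ennpowr (G e f y) (q / \<kappa>) * ennreal (1 / u y)) \<kappa> =
           ennpowr (G e f y) q * ennreal ((1 / u y) powr \<kappa>)"
        using ex by (simp add: ennpowr_mult ennpowr_ennpowr ennpowr_ennreal u_def)
      moreover have "ennreal (u y * (1 / u y) powr \<kappa>) = ennreal (u y) * ennreal ((1 / u y) powr \<kappa>)"
        by (intro ennreal_mult) (auto simp: u_def)
      ultimately show ?thesis by (simp add: mult_ac)
    qed
    show "AE y in lebesgue. ennreal (u y) * ennpowr (ennpowr (G e f y) (q / \<kappa>) * ennreal (1 / u y)) \<kappa> =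
       ennreal (\<sigma> y) * ennpowr (G e f y) q"
      using w_pos by eventually_elim (rule *)
  qed
  also have "\<dots> = (\<integral>\<^sup>+y. ennpowr (G e f y) q \<partial>S)"
    using ex unfolding S_def by (intro nn_integral_density[symmetric]) measurable
  also have "\<dots> \<le> ennreal (p * 2 powr p / (p - 1)) *
       ennpowr (\<integral>\<^sup>+y. ennpowr (ennreal (\<bar>f y\<bar> / \<sigma> y)) p \<partial>S) (q / p)"
    using p pq unfolding G_def by (intro S.frac_max_strong) (auto simp: a_def)
  also have "(\<integral>\<^sup>+y. ennpowr (ennreal (\<bar>f y\<bar> / \<sigma> y)) p \<partial>S) =
      (\<integral>\<^sup>+y. ennreal (\<sigma> y) * ennpowr (ennreal (\<bar>f y\<bar> / \<sigma> y)) p \<partial>lebesgue)"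
    using p unfolding S_def by (intro nn_integral_density) measurable
  also have "\<dots> = (\<integral>\<^sup>+x. ennpowr (ennreal \<bar>f x\<bar>) p * ennreal (w x powr p) \<partial>lebesgue)"
  proof (rule nn_integral_cong_AE)
    have *: "ennreal (\<sigma> y) * ennpowr (ennreal (\<bar>f y\<bar> / \<sigma> y)) p =
        ennpowr (ennreal \<bar>f y\<bar>) p * ennreal (w y powr p)" if y: "0 < w y" for y
    proof -
      have "\<sigma> y * (\<bar>f y\<bar> / \<sigma> y) powr p = \<bar>f y\<bar> powr p * (w y powr (- p') * w y powr (p' * p))"
        using y by (simp add: \<sigma>_def powr_divide powr_powr powr_minus powr_mult field_simps)
      also have "w y powr (- p') * w y powr (p' * p) = w y powr p"
        using ex(8) by (simp add: powr_add[symmetric] algebra_simps)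
      finally have "\<sigma> y * (\<bar>f y\<bar> / \<sigma> y) powr p = \<bar>f y\<bar> powr p * w y powr p" .
      then show ?thesis
        using p by (simp add: ennpowr_ennreal \<sigma>_def flip: ennreal_mult)
    qed
    show "AE y in lebesgue. ennreal (\<sigma> y) * ennpowr (ennreal (\<bar>f y\<bar> / \<sigma> y)) p =
        ennpowr (ennreal \<bar>f y\<bar>) p * ennreal (w y powr p)"
      using w_pos by eventually_elim (rule *)
  qed
  finally show ?thesis
    by (simp add: mult_left_mono)
qed

section \<open>Testing the class condition on the enlarged cube; \<open>\<delta>\<close> is the
  parameter \<gamma>/3 of the class\<close>

definition "\<delta> = \<theta> / \<kappa> / 3"
definition "K0 = 12 powr ((\<delta> + real CARD('n)) * (a * \<kappa>))"

lemma K0_pos: "0 < K0"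
  by (simp add: K0_def)

lemma delta_pos: "0 < \<delta>"
  using \<theta> exponents by (simp add: \<delta>_def)

lemma Apq_const_delta: "Apq_const V \<delta> p q w = ennreal A"
  using A by (simp add: \<delta>_def \<kappa>_def p'_def)

text \<open>\<open>D\<close> stands for \<open>\<psi>(12Q)|12Q|\<close>, \<open>z\<close> for \<open>1 + \<ell>(Q)/\<rho>(c\<^sub>Q)\<close> and \<open>L\<close> for \<open>|Q|\<close>.\<close>

lemma testing_bound:
  assumes z: "1 \<le> z" and L: "0 < L" and us: "0 < u0" "0 < s0" and D: "0 < D"
    and D_le: "D \<le> 12 powr (\<delta> + real CARD('n)) * (z powr \<delta> * L)"
    and le: "u0 * s0 powr (q / p') \<le> A * D powr (1 + q / p')"
  shows "1 / (z powr \<theta> * L) powr a \<le> K0 * A powr b * ((L / u0) powr b * (1 / s0 powr a))"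
proof -
  note ex = exponents
  have b1: "q / p' * b = a" and b2: "(1 + q / p') * b = a * \<kappa>" and b3: "a * \<kappa> = a + b"
    using ex by (simp_all add: b_def \<kappa>_def field_simps)
  \<comment> \<open>The power b turns the exponent q/p' of \<open>s0\<close> into a.\<close>
  have "u0 powr b * s0 powr a = (u0 * s0 powr (q / p')) powr b"
    using us b1 by (simp add: powr_mult powr_powr)
  also have "\<dots> \<le> (A * D powr (1 + q / p')) powr b"
    using le us ex by (intro powr_mono2) auto
  also have "\<dots> = A powr b * D powr (a * \<kappa>)"
    using A0 D by (simp add: powr_mult powr_powr b2)
  also have "D powr (a * \<kappa>) \<le> (12 powr (\<delta> + real CARD('n)) * (z powr \<delta> * L)) powr (a * \<kappa>)"
    using D D_le ex by (intro powr_mono2) auto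
  also have "\<dots> = K0 * (z powr (\<delta> * (a * \<kappa>)) * L powr (a * \<kappa>))"
    using z L by (simp add: powr_mult powr_powr K0_def)
  \<comment> \<open>Here \<open>\<delta> * \<kappa>\<close> = \<theta>/3, so the left exponent is
    \<theta> a / 3, and z is at least 1.\<close>
  also have "z powr (\<delta> * (a * \<kappa>)) \<le> z powr (\<theta> * a)"
    using z ex \<theta> by (intro powr_mono) (auto simp: \<delta>_def field_simps)
  also have "L powr (a * \<kappa>) = L powr a * L powr b"
    by (simp add: b3 powr_add)
  finally have main: "u0 powr b * s0 powr a \<le> A powr b * (K0 * (z powr (\<theta> * a) * (L powr a * L powr b)))"
    using K0_pos by (simp add: mult_left_mono mult_right_mono)
  have "1 / (z powr \<theta> * L) powr a = 1 / (z powr (\<theta> * a) * L powr a)"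
    using z L by (simp add: powr_mult powr_powr)
  also have "\<dots> \<le> K0 * A powr b * L powr b / (u0 powr b * s0 powr a)"
    using main z L us by (simp add: field_simps)
  also have "\<dots> = K0 * A powr b * ((L / u0) powr b * (1 / s0 powr a))"
    using L us by (simp add: powr_divide)
  finally show ?thesis .
qed

text \<open>\<open>L\<close> will be the volume of the cube, a lower bound for that of the cell, so
  that it matches the \<open>L\<close> of \<open>testing_bound\<close>.\<close>

lemma H_ge:
  assumes f [measurable]: "f \<in> borel_measurable lebesgue" and x: "x \<in> cell e k c"
    and fin: "0 < u0" "0 < s0" "emeasure U (cell e k c) = ennreal u0" "emeasure S (cell e k c) = ennreal s0"
    and L: "0 < L" "ennreal L \<le> emeasure lebesgue (cell e k c)"
  shows "(\<integral>\<^sup>+y\<in>cell e k c. ennreal \<bar>f y\<bar> \<partial>lebesgue) * ennreal ((L / u0) powr b * (1 / s0 powr a))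
     \<le> ennpowr (H e f x) b"
proof -
  note ex = exponents
  let ?P = "cell e k c"
  let ?I = "\<integral>\<^sup>+y\<in>?P. ennreal \<bar>f y\<bar> \<partial>lebesgue"
  let ?J = "?I * ennreal (1 / s0 powr a)"
  have G: "?J \<le> G e f y" if y: "y \<in> ?P" for y
  proof -
    have "cell e k y = ?P"
      using y by (simp add: cell_def)
    then have "(\<integral>\<^sup>+y\<in>?P. ennreal (\<bar>f y\<bar> / \<sigma> y) \<partial>S) / ennpowr (emeasure S ?P) a \<le> G e f y"
      unfolding G_def S.frac_max_def by (intro SUP_upper2[of k]) auto
    then show ?thesis
      using fin ex by (simp add: S_integral ennpowr_ennreal divide_ennreal_def inverse_ennreal inverse_eq_divide)
  qed
  have "ennreal L * ennpowr ?J (q / \<kappa>) \<le> emeasure lebesgue ?P * ennpowr ?J (q / \<kappa>)"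
    using L(2) by (rule mult_right_mono) simp
  also have "\<dots> = (\<integral>\<^sup>+y\<in>?P. ennpowr ?J (q / \<kappa>) \<partial>lebesgue)"
    by (subst nn_integral_cmult_indicator[OF cell_lebesgue]) (rule mult.commute)
  also have "\<dots> \<le> (\<integral>\<^sup>+y\<in>?P. ennpowr (G e f y) (q / \<kappa>) \<partial>lebesgue)"
    using G ex by (intro nn_integral_mono) (auto intro!: ennpowr_mono split: split_indicator)
  also have "\<dots> = (\<integral>\<^sup>+y\<in>?P. ennpowr (G e f y) (q / \<kappa>) * ennreal (1 / u y) \<partial>U)"
    using ex by (intro U_integral[symmetric]) measurable
  finally have "ennreal L * ennpowr ?J (q / \<kappa>) / ennreal u0 \<le>
      U.avg (\<lambda>y. ennpowr (G e f y) (q / \<kappa>) * ennreal (1 / u y)) ?P"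
    unfolding U.avg_def fin by (rule divide_right_mono_ennreal)
  also have "?P = cell e k x"
    using x by (simp add: cell_def)
  also have "U.avg (\<lambda>y. ennpowr (G e f y) (q / \<kappa>) * ennreal (1 / u y)) (cell e k x) \<le> H e f x"
    unfolding H_def U.maximal_def by (intro SUP_upper) auto
  finally have H: "ennreal L * ennpowr ?J (q / \<kappa>) / ennreal u0 \<le> H e f x"
    by (simp add: \<open>?P = cell e k x\<close>)
  have "ennreal L * ennpowr ?J (q / \<kappa>) / ennreal u0 = ennreal (L / u0) * ennpowr ?J (q / \<kappa>)"
    using fin L by (simp add: divide_ennreal_def inverse_ennreal ennreal_mult divide_inverse mult_ac)
  then have "ennpowr (ennreal (L / u0) * ennpowr ?J (q / \<kappa>)) b \<le> ennpowr (H e f x) b"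
    using H ex by (intro ennpowr_mono) auto
  also have "ennpowr (ennreal (L / u0) * ennpowr ?J (q / \<kappa>)) b = ennreal ((L / u0) powr b) * ?J"
  proof -
    have "0 < q / \<kappa>" "q / \<kappa> * b = 1"
      using ex(1,3,7) by (simp_all add: mult.commute)
    then show ?thesis
      using ex(5) fin L by (simp only: ennpowr_mult ennpowr_ennpowr ennpowr_one) (simp add: ennpowr_ennreal)
  qed
  finally show ?thesis
    by (subst ennreal_mult) (simp_all only: mult_ac, auto)
qed

text \<open>The grid depends on the cube, hence the existential; \<open>testing_bound\<close> and
  \<open>H_ge\<close> meet here.\<close>

lemma cube_average_le:
  assumes f [measurable]: "f \<in> borel_measurable lebesgue" and l: "0 < l" and x: "x \<in> cube c l"
  shows "\<exists>e. 1 / ennpowr (psi V \<theta> c l * cube_vol c l) a * (\<integral>\<^sup>+y\<in>cube c l. ennreal \<bar>f y\<bar> \<partial>lebesgue)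
     \<le> ennreal (K0 * A powr b) * ennpowr (H e f x) b"
proof (cases "critical_radius V c = 0")
  case True
  \<comment> \<open>With zero critical radius the factor psi is infinite and the left side of the
    claim is 0.\<close>
  then have "psi V \<theta> c l = top"
    using l \<theta> by (simp add: psi_def divide_ennreal_def ennreal_mult_top)
  then show ?thesis
    using l exponents by (simp add: cube_vol_eq ennreal_top_mult divide_ennreal_def)
next
  case False
  note ex = exponents
  have "ennreal l / critical_radius V c < top"
    using False by (simp add: ennreal_divide_eq_top_iff less_top[symmetric])
  then obtain t where t: "ennreal l / critical_radius V c = ennreal t" "0 \<le> t"
    by (cases "ennreal l / critical_radius V c") auto
  define z where "z = 1 + t"
  have z: "1 \<le> z" using t by (simp add: z_def)
  have psi: "psi V \<theta> c l = ennreal (z powr \<theta>)"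
    using t \<theta> by (simp add: psi_def z_def ennpowr_ennreal flip: ennreal_plus ennreal_1)
  have "ennreal (12 * l) / critical_radius V c = ennreal (12 * t)"
    using t l by (simp add: ennreal_mult divide_ennreal_def mult.assoc)
  then have psi12: "psi V \<delta> c (12 * l) = ennreal ((1 + 12 * t) powr \<delta>)"
    using t delta_pos by (simp add: psi_def ennpowr_ennreal flip: ennreal_plus ennreal_1)
  let ?n = "CARD('n)"
  define L where "L = l ^ ?n"
  have L: "0 < L" "cube_vol c l = ennreal L"
    using l by (simp_all add: L_def cube_vol_eq)
  define D where "D = (1 + 12 * t) powr \<delta> * (12 * l) ^ ?n"
  have D: "0 < D" "psi V \<delta> c (12 * l) * cube_vol c (12 * l) = ennreal D"
    using t l by (simp_all add: D_def psi12 cube_vol_eq ennreal_mult)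
  \<comment> \<open>From 1 + 12t \<le> 12(1 + t): the only comparison of psi at two scales, at the
    same centre.\<close>
  have "(1 + 12 * t) powr \<delta> \<le> (12 * z) powr \<delta>"
    using t delta_pos by (intro powr_mono2) (auto simp: z_def)
  then have "D \<le> (12 * z) powr \<delta> * (12 * l) ^ ?n"
    using l unfolding D_def by (intro mult_right_mono) auto
  also have "\<dots> = 12 powr (\<delta> + real ?n) * (z powr \<delta> * L)"
    using z by (simp add: powr_mult powr_add powr_realpow power_mult_distrib L_def)
  finally have D_le: "D \<le> 12 powr (\<delta> + real ?n) * (z powr \<delta> * L)" .
  obtain e k where ek: "cube c l \<subseteq> cell e k c" "cell e k c \<subseteq> cube c (12 * l)"
    using cube_subset_cell_subset_cube[OF l] by blast
  let ?P = "cell e k c" and ?B = "cube c (12 * l)"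
  have cube_sets [measurable]: "cube c r \<in> sets lebesgue" for r
    by (simp add: cube_def)
  have P_ge: "ennreal L \<le> emeasure lebesgue ?P"
    unfolding L(2)[symmetric] cube_vol_def using ek by (intro emeasure_mono) auto
  then have "0 < emeasure lebesgue ?P"
    using L by (metis ennreal_less_zero_iff order_less_le_trans)
  then have pos: "0 < emeasure U ?P" "0 < emeasure S ?P"
    by (simp_all add: emeasure_pos)
  \<comment> \<open>The condition is tested on 12Q and only then shrunk to the cell, leaving the
    normalization \<open>D\<close> of 12Q in place.\<close>
  have A_ge: "(ennreal (1 / D) * emeasure U ?P) * ennpowr (ennreal (1 / D) * emeasure S ?P) (q / p') \<le> ennreal A"
  proof -
    have "(ennreal (1 / D) * emeasure U ?P) * ennpowr (ennreal (1 / D) * emeasure S ?P) (q / p') \<le>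
      (ennreal (1 / D) * emeasure U ?B) * ennpowr (ennreal (1 / D) * emeasure S ?B) (q / p')"
      using ek ex by (intro mult_mono ennpowr_mono emeasure_mono) auto
    also have "\<dots> = (1 / (psi V \<delta> c (12 * l) * cube_vol c (12 * l)) *
           (\<integral>\<^sup>+y\<in>?B. ennreal (w y powr q) \<partial>lebesgue)) *
        ennpowr (1 / (psi V \<delta> c (12 * l) * cube_vol c (12 * l)) *
           (\<integral>\<^sup>+y\<in>?B. ennreal (w y powr (- conj_exponent p)) \<partial>lebesgue))
          (q / conj_exponent p)"
      using D(1) unfolding D(2)
      by (simp add: emeasure_U emeasure_S u_def \<sigma>_def p'_def divide_ennreal flip: ennreal_1)
    also have "\<dots> \<le> Apq_const V \<delta> p q w"
      unfolding Apq_const_def by (intro SUP_upper2[of c] SUP_upper2[of "12 * l"]) (use l in auto)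
    finally show ?thesis by (simp add: Apq_const_delta)
  qed
  have pos': "0 < ennreal (1 / D) * emeasure U ?P" "0 < ennreal (1 / D) * emeasure S ?P"
    using pos D by (simp_all add: ennreal_zero_less_mult_iff)
  have "0 < ennpowr (ennreal (1 / D) * emeasure S ?P) (q / p')"
    using pos'(2) ex by (cases "ennreal (1 / D) * emeasure S ?P") (auto simp: ennpowr_ennreal)
  \<comment> \<open>Neither w^q nor w^(-p') is assumed locally integrable. Finiteness on the cell
    follows because the product is finite and neither factor is zero.\<close>
  note fin = ennreal_factors_finite[OF order.strict_trans1[OF A_ge ennreal_less_top] pos'(1) this]
  have "emeasure U ?P < top"
    using fin(1) D by (auto simp: ennreal_mult_less_top)
  then obtain u0 where u0: "emeasure U ?P = ennreal u0" "0 < u0"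
    using pos(1) by (cases "emeasure U ?P") auto
  have "emeasure S ?P < top"
    using fin(2) D ex by (cases "emeasure S ?P") (auto simp: ennreal_mult_top)
  then obtain s0 where s0: "emeasure S ?P = ennreal s0" "0 < s0"
    using pos(2) by (cases "emeasure S ?P") auto
  have "(u0 / D) * (s0 / D) powr (q / p') \<le> A"
    using A_ge u0 s0 D A0 ex by (simp add: ennpowr_ennreal flip: ennreal_mult)
  then have "u0 * s0 powr (q / p') \<le> A * D powr (1 + q / p')"
    using D s0 by (simp add: powr_divide powr_add field_simps)
  then have bound: "1 / (z powr \<theta> * L) powr a \<le> K0 * A powr b * ((L / u0) powr b * (1 / s0 powr a))"
    using testing_bound[OF z L(1) u0(2) s0(2) D(1) D_le] by blast
  let ?I = "\<integral>\<^sup>+y\<in>?P. ennreal \<bar>f y\<bar> \<partial>lebesgue"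
  have "1 / ennpowr (psi V \<theta> c l * cube_vol c l) a = ennreal (1 / (z powr \<theta> * L) powr a)"
    using z L ex by (simp add: psi ennpowr_ennreal divide_ennreal flip: ennreal_mult ennreal_1)
  then have "1 / ennpowr (psi V \<theta> c l * cube_vol c l) a * (\<integral>\<^sup>+y\<in>cube c l. ennreal \<bar>f y\<bar> \<partial>lebesgue) \<le>
      ennreal (K0 * A powr b * ((L / u0) powr b * (1 / s0 powr a))) * ?I"
    using bound ek by (auto intro!: mult_mono ennreal_leI nn_set_integral_set_mono)
  also have "\<dots> = ennreal (K0 * A powr b) * (?I * ennreal ((L / u0) powr b * (1 / s0 powr a)))"
    using K0_pos by (subst ennreal_mult) (simp_all only: mult_ac, auto)
  also have "\<dots> \<le> ennreal (K0 * A powr b) * ennpowr (H e f x) b"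
    using x ek u0 s0 L P_ge by (intro mult_left_mono H_ge) auto
  finally show ?thesis by blast
qed

text \<open>The number of grids times the two strong-type constants, under a q-th root.\<close>

definition "K1 = (2 ^ CARD('n) * (\<kappa> * 2 powr \<kappa> / (\<kappa> - 1)) * (p * 2 powr p / (p - 1))) powr (1 / q)"

lemma K1_pos: "0 < K1"
  using exponents p by (simp add: K1_def)

text \<open>A sum over grids absorbs the dependence of the grid on the cube. Placing it inside the
  power 1/q makes the q-th power of the bound additive in the grids.\<close>

lemma frac_maximal_le:
  assumes f [measurable]: "f \<in> borel_measurable lebesgue" and \<alpha>: "1 - \<alpha> / real CARD('n) = a"
  shows "frac_maximal V \<theta> \<alpha> f x \<le>
     ennreal (K0 * A powr b) * ennpowr (\<Sum>e\<in>UNIV. ennpowr (H e f x) \<kappa>) (1 / q)"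
  unfolding frac_maximal_def \<alpha>
proof (intro SUP_least)
  note ex = exponents
  fix c l assume "l \<in> {0 :: real<..}"
  then have l: "0 < l" by simp
  show "indicator (cube c l) x / ennpowr (psi V \<theta> c l * cube_vol c l) a *
      (\<integral>\<^sup>+y\<in>cube c l. ennreal \<bar>f y\<bar> \<partial>lebesgue) \<le>
      ennreal (K0 * A powr b) * ennpowr (\<Sum>e\<in>UNIV. ennpowr (H e f x) \<kappa>) (1 / q)"
  proof (cases "x \<in> cube c l")
    case True
    then obtain e where "1 / ennpowr (psi V \<theta> c l * cube_vol c l) a *
        (\<integral>\<^sup>+y\<in>cube c l. ennreal \<bar>f y\<bar> \<partial>lebesgue) \<le> ennreal (K0 * A powr b) * ennpowr (H e f x) b"
      using cube_average_le[OF f l] by blast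
    also have "ennpowr (H e f x) b = ennpowr (ennpowr (H e f x) \<kappa>) (1 / q)"
    proof -
      have "\<kappa> * (1 / q) = b" using ex(1) ex(7)[symmetric] by simp
      then show ?thesis using ex by (simp add: ennpowr_ennpowr)
    qed
    also have "\<dots> \<le> ennpowr (\<Sum>e\<in>UNIV. ennpowr (H e f x) \<kappa>) (1 / q)"
      using ex by (intro ennpowr_mono member_le_sum) auto
    finally show ?thesis
      using True by (simp add: mult_left_mono)
  qed simp
qed

lemma frac_maximal_norm_le:
  assumes f [measurable]: "f \<in> borel_measurable lebesgue" and \<alpha>: "1 - \<alpha> / real CARD('n) = a"
  shows "Lp_norm q (\<lambda>x. w x powr q) (frac_maximal V \<theta> \<alpha> f) \<le>
     ennreal (K0 * K1 * A powr b) * Lp_norm p (\<lambda>x. w x powr p) (\<lambda>x. ennreal \<bar>f x\<bar>)"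
proof -
  note ex = exponents
  let ?K = "ennreal (K0 * A powr b)"
  let ?N = "\<integral>\<^sup>+x. ennpowr (ennreal \<bar>f x\<bar>) p * ennreal (w x powr p) \<partial>lebesgue"
  define C where "C = (\<kappa> * 2 powr \<kappa> / (\<kappa> - 1)) * (p * 2 powr p / (p - 1))"
  have C: "0 < C" using ex p by (simp add: C_def)
  \<comment> \<open>Only monotonicity of the integral is used for the maximal function;
    measurability is required only of the majorant.\<close>
  have "(\<integral>\<^sup>+x. ennpowr (frac_maximal V \<theta> \<alpha> f x) q * ennreal (w x powr q) \<partial>lebesgue) \<le>
      (\<integral>\<^sup>+x. ennpowr ?K q * (\<Sum>e\<in>UNIV. ennreal (u x) * ennpowr (H e f x) \<kappa>) \<partial>lebesgue)"
  proof (intro nn_integral_mono)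
    fix x
    have "ennpowr (frac_maximal V \<theta> \<alpha> f x) q \<le>
        ennpowr (?K * ennpowr (\<Sum>e\<in>UNIV. ennpowr (H e f x) \<kappa>) (1 / q)) q"
      using ex by (intro ennpowr_mono frac_maximal_le f \<alpha>) auto
    also have "\<dots> = ennpowr ?K q * (\<Sum>e\<in>UNIV. ennpowr (H e f x) \<kappa>)"
      using ex by (simp add: ennpowr_mult ennpowr_ennpowr)
    finally have "ennpowr (frac_maximal V \<theta> \<alpha> f x) q * ennreal (u x) \<le>
        ennpowr ?K q * (\<Sum>e\<in>UNIV. ennpowr (H e f x) \<kappa>) * ennreal (u x)"
      by (rule mult_right_mono) simp
    then show "ennpowr (frac_maximal V \<theta> \<alpha> f x) q * ennreal (w x powr q) \<le>
        ennpowr ?K q * (\<Sum>e\<in>UNIV. ennreal (u x) * ennpowr (H e f x) \<kappa>)"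
      by (simp add: u_def sum_distrib_left mult_ac)
  qed
  also have "\<dots> = ennpowr ?K q * (\<Sum>e\<in>UNIV. \<integral>\<^sup>+x. ennreal (u x) * ennpowr (H e f x) \<kappa> \<partial>lebesgue)"
    using ex by (simp add: nn_integral_cmult nn_integral_sum)
  also have "\<dots> \<le> ennpowr ?K q * (\<Sum>e\<in>(UNIV :: ('n \<Rightarrow> bool) set). ennreal C * ennpowr ?N (q / p))"
  proof (intro mult_left_mono sum_mono)
    fix e :: "'n \<Rightarrow> bool"
    have "ennreal C = ennreal (\<kappa> * 2 powr \<kappa> / (\<kappa> - 1)) * ennreal (p * 2 powr p / (p - 1))"
      unfolding C_def using ex p by (intro ennreal_mult) auto
    then show "(\<integral>\<^sup>+x. ennreal (u x) * ennpowr (H e f x) \<kappa> \<partial>lebesgue) \<le> ennreal C * ennpowr ?N (q / p)"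
      using H_strong[OF f, of e] by (simp add: mult.assoc)
  qed simp
  also have "\<dots> = ennpowr ?K q * (ennreal (2 ^ CARD('n) * C) * ennpowr ?N (q / p))"
    using C by (simp add: card_fun ennreal_mult mult.assoc flip: ennreal_numeral ennreal_power)
  finally have "Lp_norm q (\<lambda>x. w x powr q) (frac_maximal V \<theta> \<alpha> f) \<le>
     ennpowr (ennpowr ?K q * (ennreal (2 ^ CARD('n) * C) * ennpowr ?N (q / p))) (1 / q)"
    unfolding Lp_norm_def using ex by (intro ennpowr_mono) auto
  also have "\<dots> = ?K * (ennreal K1 * ennpowr ?N (1 / p))"
    using ex p C by (simp add: ennpowr_mult ennpowr_ennpowr ennpowr_ennreal K1_def C_def mult.assoc)
  also have "\<dots> = ennreal (K0 * K1 * A powr b) * ennpowr ?N (1 / p)"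
    using K0_pos K1_pos by (simp add: ennreal_mult mult_ac)
  finally show ?thesis
    by (simp add: Lp_norm_def)
qed

end

section \<open>Assembly, with the constant fixed before the weight\<close>

theorem theorem1p2:
  fixes V :: "real ^ 'n \<Rightarrow> real" and s :: ennreal and \<theta> \<alpha> p q \<gamma> :: real
  assumes "CARD('n) \<ge> 3"
    and "locally_integrable V" and "\<forall>x. V x \<ge> 0"
    and "s \<ge> ennreal (real CARD('n) / 2)" and "reverse_Hoelder s V"
    and "\<theta> > 0" and "0 \<le> \<alpha>" and "\<alpha> < real CARD('n)"
    and "1 < p" and "p \<le> q" and "1 / p - 1 / q = \<alpha> / real CARD('n)"
    and "\<gamma> = \<theta> / (1 + conj_exponent p / q)"
  shows "\<exists>C::real. C > 0 \<and> (\<forall>w \<in> Apq_class V (\<gamma> / 3) p q.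
           op_norm p (\<lambda>x. w x powr p) q (\<lambda>x. w x powr q) (frac_maximal V \<theta> \<alpha>)
           \<le> ennreal C * ennpowr (Apq_const V (\<gamma> / 3) p q w)
                 (conj_exponent p / q * (1 - \<alpha> / real CARD('n))))"
\<comment> \<open>Positivity of \<open>K0\<close> and \<open>K1\<close> is proved inside the locale,
  so it takes some weight in the class to obtain it.\<close>
proof (cases "Apq_class V (\<gamma> / 3) p q = {}")
  case False
  have weight: "Apq_weight V \<theta> p q (enn2real (Apq_const V (\<gamma> / 3) p q w)) w"
    if "w \<in> Apq_class V (\<gamma> / 3) p q" for w
    using that assms by unfold_locales (auto simp: Apq_class_def)
  \<comment> \<open>Outside the locale, these constants visibly depend on the dimension, \<theta>, p
    and q alone.\<close>
  define C where "C = Apq_weight.K0 TYPE('n) \<theta> p q * Apq_weight.K1 TYPE('n) p q"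
  have "0 < C"
    using False weight Apq_weight.K0_pos Apq_weight.K1_pos unfolding C_def
    by (metis all_not_in_conv mult_pos_pos)
  moreover have "op_norm p (\<lambda>x. w x powr p) q (\<lambda>x. w x powr q) (frac_maximal V \<theta> \<alpha>)
           \<le> ennreal C * ennpowr (Apq_const V (\<gamma> / 3) p q w)
                 (conj_exponent p / q * (1 - \<alpha> / real CARD('n)))"
    if w: "w \<in> Apq_class V (\<gamma> / 3) p q" for w
  proof -
    define A where "A = enn2real (Apq_const V (\<gamma> / 3) p q w)"
    interpret Apq_weight V \<theta> p q A w
      unfolding A_def by (rule weight[OF w])
    have \<alpha>: "1 - \<alpha> / real CARD('n) = a"
      using assms(11) by (simp add: a_def)
    have b: "conj_exponent p / q * (1 - \<alpha> / real CARD('n)) = b"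
      by (simp add: \<alpha> b_def p'_def)
    have A_eq: "Apq_const V (\<gamma> / 3) p q w = ennreal A"
      using A by (simp add: assms(12))
    have C: "ennreal C * ennpowr (ennreal A) b = ennreal (K0 * K1 * A powr b)"
      using K0_pos K1_pos A0 exponents by (simp add: C_def ennpowr_ennreal ennreal_mult)
    show ?thesis
      unfolding op_norm_def b A_eq C
    proof (rule SUP_least)
      fix f assume "f \<in> Lp_space p (\<lambda>x. w x powr p)"
      then have f: "f \<in> borel_measurable lebesgue"
        and fin: "Lp_norm p (\<lambda>x. w x powr p) (\<lambda>x. ennreal \<bar>f x\<bar>) < top" (is "?N < top")
        by (auto simp: Lp_space_def)
      have le: "Lp_norm q (\<lambda>x. w x powr q) (frac_maximal V \<theta> \<alpha> f) \<le> ennreal (K0 * K1 * A powr b) * ?N"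
        by (rule frac_maximal_norm_le[OF f \<alpha>])
      show "Lp_norm q (\<lambda>x. w x powr q) (frac_maximal V \<theta> \<alpha> f) / ?N \<le> ennreal (K0 * K1 * A powr b)"
      \<comment> \<open>If the norm of \<open>f\<close> vanishes, \<open>le\<close> makes the
        numerator vanish too, and the quotient is 0.\<close>
      proof (cases "?N = 0")
        case True
        then show ?thesis using le by simp
      next
        case False
        then show ?thesis
          using divide_right_mono_ennreal[OF le, of ?N] fin by (simp add: mult_divide_eq_ennreal)
      qed
    qed
  qed
  ultimately show ?thesis by blast
qed (auto intro: exI[of _ 1])

end
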